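(* There is a constant $L$ such that the following holds. Let $n$ be an M-number with $\ell=\omega(n_R)\ge L$ non-tight prime factors, let $j=\lfloor\sqrt{\ell}\rfloor$, and suppose that $n$ is not divisible by $q^2$ for any non-tight prime $q>p_j$, where $p_j$ denotes the $j$-th odd prime. Then $n$ is matchable.
   Context: For a positive integer $n$, let $D(n)$ be its set of positive divisors, $\tau(n)=|D(n)|$, $\omega(n)$ the number of distinct prime factors, and $v_p(n)$ the exponent of the prime $p$ in $n$. A positive integer $n$ is matchable if there is a bijection $\psi:\{1,\dots,\tau(n)\}\to D(n)$ with $\gcd(x,\psi(x))=1$ for all $x$. An M-number is a positive integer $n$ with $v_p(n)\le p-1$ for all primes $p$. A prime $p\mid n$ is tight if $v_p(n)=p-1$ and non-tight otherwise; $n_T=\prod_{p\mid n,\ p\text{ tight}}p^{p-1}$ and $n_R=n/n_T$. *)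

theory Defs
  imports "HOL-Number_Theory.Number_Theory" "HOL-Library.Infinite_Set"
begin

definition divisors :: "nat \<Rightarrow> nat set" where
  "divisors n = {d. d dvd n}"

definition tau :: "nat \<Rightarrow> nat" where
  "tau n = card (divisors n)"

definition omega :: "nat \<Rightarrow> nat" where
  "omega n = card (prime_factors n)"

definition matchable :: "nat \<Rightarrow> bool" where
  "matchable n \<longleftrightarrow> n > 0 \<and>
     (\<exists>\<psi>. bij_betw \<psi> {1..tau n} (divisors n) \<and> (\<forall>x\<in>{1..tau n}. coprime x (\<psi> x)))"

definition M_number :: "nat \<Rightarrow> bool" where
  "M_number n \<longleftrightarrow> n > 0 \<and> (\<forall>p. prime p \<longrightarrow> multiplicity p n \<le> p - 1)"

definition tight :: "nat \<Rightarrow> nat \<Rightarrow> bool" where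
  "tight n p \<longleftrightarrow> p \<in> prime_factors n \<and> multiplicity p n = p - 1"

definition non_tight :: "nat \<Rightarrow> nat \<Rightarrow> bool" where
  "non_tight n p \<longleftrightarrow> p \<in> prime_factors n \<and> multiplicity p n \<noteq> p - 1"

definition tight_part :: "nat \<Rightarrow> nat" where
  "tight_part n = (\<Prod>p | tight n p. p ^ (p - 1))"

definition non_tight_part :: "nat \<Rightarrow> nat" where
  "non_tight_part n = n div tight_part n"

(* Indexed from 1: odd_prime 1 = 3, odd_prime 2 = 5, odd_prime 3 = 7.
   The value at index 0 has no meaning. *)
definition odd_prime :: "nat \<Rightarrow> nat" where
  "odd_prime j = enumerate {p. prime p \<and> odd p} (j - 1)"

end

theory Submission
  imports Defs
begin

text \<open>
  Let \<open>P\<close> be the product of the tight primes, so that \<open>P = \<tau>(n\<^sub>T)\<close>. The residues modulo \<open>P\<close> correspond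
  bijectively to the divisors of \<open>n\<^sub>T\<close> via exponents that vanish exactly at the primes dividing the residue,
  so it suffices to match each progression \<open>a + P k\<close>, \<open>k < m = \<tau>(n\<^sub>R)\<close>, with the divisors of \<open>n\<^sub>R\<close>.
  Call a prime of \<open>n\<^sub>R\<close> small if it is at most \<open>z = \<ell> div 64\<close>, and large otherwise; by Chebyshev's lower bound
  \<open>p\<^sub>j \<le> z\<close>, so the large primes have exponent 1. The product \<open>Q\<close> of the small primes is at most \<open>4\<^sup>z\<close>, much less
  than \<open>m \<ge> 2\<^sup>\<ell>\<close>, so the terms are almost equidistributed modulo \<open>Q\<close>. As each small \<open>p\<close> has exponent at most \<open>p - 2\<close>,
  the product coupling between residues modulo \<open>Q\<close> and exponent vectors has enough slack at the zero vector
  to absorb the rounding errors. Within each cell of this coupling, a term divisible by \<open>b\<close> large primes is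
  coprime to a proportion \<open>2\<^sup>-\<^sup>b\<close> of the products of large primes, whereas terms divisible by at least \<open>b\<close> large primes
  are much rarer than that, because the reciprocals of the large primes have a tiny sum. The only exception is a
  single term divisible by almost all large primes; it is matched with the divisor 1 beforehand.
\<close>

section \<open>Divisors and residues\<close>

text \<open>Chinese remainder theorem: injectivity together with equal cardinalities. The shift
  \<open>c\<close> is 0 for the coupling and 1 for the reduction, where arguments start at
  1.\<close>

lemma bij_betw_residues:
  fixes S :: "nat set"
  assumes "finite S" "\<And>p. p \<in> S \<Longrightarrow> prime p"
  shows "bij_betw (\<lambda>k. \<lambda>p\<in>S. (c + k) mod p) {..<\<Prod>S} (\<Pi>\<^sub>E p\<in>S. {..<p})"
proof -
  let ?f = "\<lambda>k. \<lambda>p\<in>S. (c + k) mod p"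
  have "inj_on ?f {..<\<Prod>S}"
  proof (rule inj_onI)
    fix x y assume xy: "x \<in> {..<\<Prod>S}" "y \<in> {..<\<Prod>S}" "?f x = ?f y"
    have "[x = y] (mod p)" if "p \<in> S" for p
      using fun_cong[OF xy(3), of p] that by (simp add: cong_add_lcancel_nat flip: cong_def)
    then have "[x = y] (mod (\<Prod>p\<in>S. p))"
      using assms by (intro coprime_cong_prod_nat primes_coprime) auto
    then show "x = y" using xy by (simp add: cong_def)
  qed
  moreover have "?f ` {..<\<Prod>S} \<subseteq> (\<Pi>\<^sub>E p\<in>S. {..<p})"
    using assms by (auto simp: prime_gt_0_nat)
  moreover have "card (\<Pi>\<^sub>E p\<in>S. {..<p}) = card {..<\<Prod>S}"
    using assms by (simp add: card_PiE)
  ultimately show ?thesis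
    using assms by (simp add: bij_betw_def card_image card_subset_eq finite_PiE)
qed

text \<open>Residues modulo distinct primes vary independently, so the sum factorises. This gives
  the column sums of the coupling.\<close>

lemma sum_prod_residues:
  fixes h :: "nat \<Rightarrow> nat \<Rightarrow> 'a :: comm_semiring_1"
  assumes "finite S" "\<And>p. p \<in> S \<Longrightarrow> prime p"
  shows "(\<Sum>c<\<Prod>S. \<Prod>p\<in>S. h p (c mod p)) = (\<Prod>p\<in>S. \<Sum>i<p. h p i)"
proof -
  have "(\<Sum>c<\<Prod>S. \<Prod>p\<in>S. h p (c mod p)) = (\<Sum>c<\<Prod>S. \<Prod>p\<in>S. h p ((\<lambda>p\<in>S. c mod p) p))"
    by (intro sum.cong prod.cong) auto
  also have "\<dots> = (\<Sum>g\<in>(\<Pi>\<^sub>E p\<in>S. {..<p}). \<Prod>p\<in>S. h p (g p))"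
    by (rule sum.reindex_bij_betw[OF bij_betw_residues[OF assms, of 0, simplified], where g = "\<lambda>g. \<Prod>p\<in>S. h p (g p)"])
  also have "\<dots> = (\<Prod>p\<in>S. \<Sum>i<p. h p i)" using assms by (intro prod_sum_PiE[symmetric]) auto
  finally show ?thesis .
qed

lemma card_cong_class_le:
  fixes d m :: nat
  assumes "d > 0" "X \<subseteq> {..<m}" "\<And>x y. x \<in> X \<Longrightarrow> y \<in> X \<Longrightarrow> [x = y] (mod d)"
  shows "real (card X) \<le> real m / real d + 1"
proof -
  have "inj_on (\<lambda>x. x div d) X"
    using assms(3) by (intro inj_onI) (metis cong_def div_mult_mod_eq)
  then have "card X = card ((\<lambda>x. x div d) ` X)" by (simp add: card_image)
  also have "\<dots> \<le> card {..m div d}"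
    using assms(2) by (intro card_mono) (auto intro!: div_le_mono)
  finally have "card X \<le> m div d + 1" by simp
  moreover have "real (m div d) \<le> real m / real d" by (rule of_nat_div_le_of_nat)
  ultimately show ?thesis by linarith
qed

lemma card_residue_class_ge:
  fixes q m c :: nat
  assumes "c < q"
  shows "real (card {k. k < m \<and> k mod q = c}) \<ge> real m / real q - 1"
proof -
  have "(\<lambda>i. c + q * i) ` {..<m div q} \<subseteq> {k. k < m \<and> k mod q = c}"
  proof (rule image_subsetI)
    fix i assume i: "i \<in> {..<m div q}"
    then have "q * (i + 1) \<le> q * (m div q)" by (intro mult_le_mono2) auto
    also have "\<dots> \<le> m" by simp
    finally have "q + q * i \<le> m" by simp
    then have "c + q * i < m" using assms by linarith
    then show "c + q * i \<in> {k. k < m \<and> k mod q = c}" using assms by simp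
  qed
  then have "card ((\<lambda>i. c + q * i) ` {..<m div q}) \<le> card {k. k < m \<and> k mod q = c}"
    by (intro card_mono) auto
  moreover have "card ((\<lambda>i. c + q * i) ` {..<m div q}) = m div q"
    using assms by (subst card_image) (auto simp: inj_on_def)
  moreover have "real m / real q - 1 \<le> real (m div q)"
    using floor_divide_of_nat_eq[of m q, where 'a = real] by linarith
  ultimately show ?thesis by linarith
qed

text \<open>Rankin's trick: the left side is the degree \<open>t\<close> part of the expanded
  product, all of whose terms are nonnegative. It is used with large \<open>y\<close> for
  reciprocals of primes and with \<open>y = 1 / 16\<close> to count subsets.\<close>

lemma sum_prod_card_eq_le:
  fixes f :: "'a \<Rightarrow> real" and y :: real
  assumes "finite A" "y > 0" "\<And>x. x \<in> A \<Longrightarrow> f x \<ge> 0"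
  shows "(\<Sum>B | B \<subseteq> A \<and> card B = t. \<Prod>x\<in>B. f x) * y ^ t \<le> (\<Prod>x\<in>A. 1 + y * f x)"
proof -
  have "(\<Sum>B | B \<subseteq> A \<and> card B = t. \<Prod>x\<in>B. f x) * y ^ t = (\<Sum>B | B \<subseteq> A \<and> card B = t. \<Prod>x\<in>B. y * f x)"
    unfolding sum_distrib_right by (intro sum.cong) (auto simp: prod.distrib mult.commute)
  also have "\<dots> \<le> (\<Sum>B\<in>Pow A. \<Prod>x\<in>B. y * f x)"
    using assms by (intro sum_mono2) (auto intro!: prod_nonneg)
  also have "\<dots> = (\<Prod>x\<in>A. y * f x + 1)" using assms(1) by (subst prod_add) auto
  finally show ?thesis by (simp add: add.commute)
qed

lemma bij_betw_exponents_divisors: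
  assumes "finite S" "\<And>p. p \<in> S \<Longrightarrow> prime p"
  shows "bij_betw (\<lambda>v. \<Prod>p\<in>S. p ^ v p) (\<Pi>\<^sub>E p\<in>S. {..e p}) (divisors (\<Prod>p\<in>S. p ^ e p))"
proof (rule bij_betwI')
  fix v w assume v: "v \<in> (\<Pi>\<^sub>E p\<in>S. {..e p})" and w: "w \<in> (\<Pi>\<^sub>E p\<in>S. {..e p})"
  show "((\<Prod>p\<in>S. p ^ v p) = (\<Prod>p\<in>S. p ^ w p)) = (v = w)"
  proof
    assume eq: "(\<Prod>p\<in>S. p ^ v p) = (\<Prod>p\<in>S. p ^ w p)"
    have "v p = w p" if "p \<in> S" for p
      using arg_cong[OF eq, of "multiplicity p"] that assms
      by (simp add: multiplicity_prod_prime_powers)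
    then show "v = w" using v w by (intro PiE_ext)
  qed simp
next
  fix v assume "v \<in> (\<Pi>\<^sub>E p\<in>S. {..e p})"
  then show "(\<Prod>p\<in>S. p ^ v p) \<in> divisors (\<Prod>p\<in>S. p ^ e p)"
    by (auto simp: divisors_def PiE_iff intro!: prod_dvd_prod le_imp_power_dvd)
next
  fix d assume "d \<in> divisors (\<Prod>p\<in>S. p ^ e p)"
  then have d: "d dvd (\<Prod>p\<in>S. p ^ e p)" by (simp add: divisors_def)
  have pos: "(\<Prod>p\<in>S. p ^ e p) > 0" using assms by (auto intro!: prod_pos simp: prime_gt_0_nat)
  with d have dpos: "d > 0" using dvd_pos_nat by blast
  have le: "multiplicity p d \<le> (if p \<in> S then e p else 0)" if "prime p" for p
  proof -
    have "multiplicity p d \<le> multiplicity p (\<Prod>p\<in>S. p ^ e p)"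
      using pos by (intro dvd_imp_multiplicity_le[OF d]) linarith
    then show ?thesis using that assms by (simp add: multiplicity_prod_prime_powers)
  qed
  have sub: "prime_factors d \<subseteq> S"
  proof
    fix p assume "p \<in> prime_factors d"
    then have "prime p" "multiplicity p d > 0" by (auto simp: prime_factors_multiplicity)
    then show "p \<in> S" using le[of p] by (auto split: if_splits)
  qed
  define v where "v = (\<lambda>p\<in>S. multiplicity p d)"
  have "d = (\<Prod>p\<in>prime_factors d. p ^ multiplicity p d)"
    using dpos by (intro prime_factorization_nat)
  also have "\<dots> = (\<Prod>p\<in>S. p ^ multiplicity p d)"
    using assms sub by (intro prod.mono_neutral_left) (auto simp: prime_factors_multiplicity)
  also have "\<dots> = (\<Prod>p\<in>S. p ^ v p)" by (intro prod.cong) (auto simp: v_def)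
  finally have "d = (\<Prod>p\<in>S. p ^ v p)" .
  moreover have "v \<in> (\<Pi>\<^sub>E p\<in>S. {..e p})"
  proof (unfold v_def, intro restrict_PiE_iff[THEN iffD2] ballI)
    fix p assume "p \<in> S"
    then show "multiplicity p d \<in> {..e p}" using le[of p] assms(2) by simp
  qed
  ultimately show "\<exists>v\<in>(\<Pi>\<^sub>E p\<in>S. {..e p}). d = (\<Prod>p\<in>S. p ^ v p)" by blast
qed

lemma card_divisors_prod_prime_powers:
  assumes "finite S" "\<And>p. p \<in> S \<Longrightarrow> prime p"
  shows "card (divisors (\<Prod>p\<in>S. p ^ e p)) = (\<Prod>p\<in>S. e p + 1)"
  using bij_betw_same_card[OF bij_betw_exponents_divisors[OF assms, of e]] assms(1)
  by (simp add: card_PiE)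

text \<open>\<open>prime_factors\<close> inverts the map on the left; surjectivity follows by
  counting, since both sets have \<open>2 ^ card R\<close> elements.\<close>

lemma bij_betw_Pow_divisors:
  assumes "finite R" "\<And>p. p \<in> R \<Longrightarrow> prime (p::nat)"
  shows "bij_betw \<Prod> (Pow R) (divisors (\<Prod>R))"
proof -
  have inj: "inj_on \<Prod> (Pow R)"
  proof (rule inj_on_inverseI[where g = prime_factors])
    fix B assume B: "B \<in> Pow R"
    have "finite B" using B assms(1) finite_subset by blast
    have primes: "prime p" if "p \<in> B" for p using that B assms(2) by blast
    have "multiplicity p (\<Prod>B) = (if p \<in> B then 1 else 0)" if "prime p" for p
      using multiplicity_prod_prime_powers[OF \<open>finite B\<close> primes that, of "\<lambda>_. 1"] by simp
    then show "prime_factors (\<Prod>B) = B"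
      unfolding prime_factors_multiplicity using primes by (auto split: if_splits)
  qed
  have "\<Prod> ` Pow R \<subseteq> divisors (\<Prod>R)"
    using assms by (auto simp: divisors_def intro!: prod_dvd_prod_subset)
  moreover have "card (\<Prod> ` Pow R) = card (divisors (\<Prod>R))"
    using card_divisors_prod_prime_powers[OF assms, of "\<lambda>_. 1"] inj assms(1)
    by (simp add: card_image card_Pow flip: numeral_2_eq_2)
  moreover have "finite (divisors (\<Prod>R))"
    using assms by (auto simp: divisors_def prime_gt_0_nat intro!: finite_divisors_nat prod_pos)
  ultimately show ?thesis using inj by (simp add: bij_betw_def card_subset_eq)
qed

lemma bij_betw_divisors_mult:
  assumes "coprime A B" "A > 0" "B > 0"
  shows "bij_betw (\<lambda>(a, b). a * b) (divisors A \<times> divisors B) (divisors (A * B))"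
proof (rule bij_betwI')
  fix x y assume "x \<in> divisors A \<times> divisors B" "y \<in> divisors A \<times> divisors B"
  then obtain a b c d where xy: "x = (a, b)" "y = (c, d)" and dvd: "a dvd A" "b dvd B" "c dvd A" "d dvd B"
    by (auto simp: divisors_def)
  \<comment> \<open>By coprimality the gcd with \<open>A\<close> recovers the first factor, which
    gives injectivity.\<close>
  have gcd_A: "gcd (u * w) A = u" if "u dvd A" "w dvd B" for u w
  proof -
    have "coprime A w" using assms(1) that by (meson coprime_divisors dvd_refl)
    then have "gcd (u * w) A = gcd u A" by (rule gcd_mult_left_right_cancel)
    then show ?thesis using that by (simp add: gcd_nat.absorb1)
  qed
  show "((case x of (a, b) \<Rightarrow> a * b) = (case y of (a, b) \<Rightarrow> a * b)) = (x = y)"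
  proof
    assume "(case x of (a, b) \<Rightarrow> a * b) = (case y of (a, b) \<Rightarrow> a * b)"
    then have eq: "a * b = c * d" using xy by simp
    then have "a = c" using gcd_A dvd by metis
    moreover have "a > 0" using dvd assms dvd_pos_nat by blast
    ultimately show "x = y" using eq xy by simp
  qed simp
next
  fix x assume "x \<in> divisors A \<times> divisors B"
  then show "(case x of (a, b) \<Rightarrow> a * b) \<in> divisors (A * B)"
    by (auto simp: divisors_def mult_dvd_mono)
next
  fix y assume "y \<in> divisors (A * B)"
  then obtain a b where "y = a * b" "a dvd A" "b dvd B"
    using division_decomp[of y A B] by (auto simp: divisors_def)
  then show "\<exists>x\<in>divisors A \<times> divisors B. y = (case x of (a, b) \<Rightarrow> a * b)"
    by (intro bexI[of _ "(a, b)"]) (auto simp: divisors_def)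
qed

lemma coprime_prod_prime_powers:
  assumes "\<And>p. p \<in> S \<Longrightarrow> prime p" "\<And>p. p \<in> S \<Longrightarrow> p dvd x \<Longrightarrow> v p = 0"
  shows "coprime (x::nat) (\<Prod>p\<in>S. p ^ v p)"
proof (rule prod_coprime_right)
  fix p assume "p \<in> S"
  then show "coprime x (p ^ v p)"
  proof (cases "p dvd x")
    case False
    then have "coprime p x" using assms \<open>p \<in> S\<close> by (intro prime_imp_coprime)
    then show ?thesis by (simp add: coprime_commute)
  qed (use assms \<open>p \<in> S\<close> in simp)
qed

section \<open>Elementary estimates for primes\<close>

lemma prod_primes_dvd:
  fixes n :: nat
  assumes "finite A" "\<And>p. p \<in> A \<Longrightarrow> prime p" "\<And>p. p \<in> A \<Longrightarrow> p dvd n"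
  shows "\<Prod>A dvd n"
  using assms
proof (induction A rule: finite_induct)
  case (insert p A)
  have "coprime p (\<Prod>A)"
    using insert by (intro prod_coprime_right primes_coprime) auto
  then show ?case using insert by (simp add: divides_mult)
qed simp

text \<open>Erdos's argument: for \<open>n = 2 * m + 1\<close> the primes above \<open>m + 1\<close>
  all divide one middle binomial coefficient, which is at most \<open>4 ^ m\<close>, and the
  remaining primes are covered by induction at \<open>m + 1\<close>.\<close>

lemma primorial_le: "(\<Prod>p | prime p \<and> p \<le> n. p) \<le> (4::nat) ^ n"
proof (induction n rule: less_induct)
  case (less n)
  consider "n \<le> 1" | "n = 2" | "n > 2" "even n" | "n > 1" "odd n" by linarith
  then show ?case
  proof cases
    case 1
    then have no_primes: "{p. prime p \<and> p \<le> n} = {}" by (auto dest!: prime_ge_2_nat)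
    show ?thesis unfolding no_primes by simp
  next
    case 2
    have "{p::nat. prime p \<and> p \<le> 2} = {2}" by (auto dest: prime_ge_2_nat)
    then show ?thesis using 2 by simp
  next
    case 3
    then have "\<not> prime n" using prime_odd_nat by blast
    then have "{p. prime p \<and> p \<le> n} = {p. prime p \<and> p \<le> n - 1}"
      by (auto simp: le_less)
    then have "(\<Prod>p | prime p \<and> p \<le> n. p) \<le> 4 ^ (n - 1)" using less[of "n - 1"] 3 by simp
    also have "\<dots> \<le> 4 ^ n" by (intro power_increasing) auto
    finally show ?thesis .
  next
    case 4
    then obtain m where m: "n = 2 * m + 1" "m \<ge> 1" by (auto elim!: oddE)
    define B where "B = {p. prime p \<and> m + 1 < p \<and> p \<le> 2 * m + 1}"
    define c where "c = (2 * m + 1) choose m"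
    have "\<Prod>B dvd c"
    proof (rule prod_primes_dvd)
      show "finite B" unfolding B_def by (rule finite_subset[of _ "{..2*m+1}"]) auto
      fix p assume p: "p \<in> B"
      then show "prime p" by (simp add: B_def)
      have "fact m * fact (2 * m + 1 - m) * c = fact (2 * m + 1)"
        unfolding c_def by (rule binomial_fact_lemma) simp
      moreover have "p dvd fact (2 * m + 1)" using p by (simp add: B_def prime_dvd_fact_iff del: fact_Suc)
      moreover have "\<not> p dvd fact m" "\<not> p dvd fact (2 * m + 1 - m)"
        using p by (simp_all add: B_def prime_dvd_fact_iff del: fact_Suc)
      ultimately show "p dvd c" using p by (metis B_def mem_Collect_eq prime_dvd_mult_nat)
    qed
    moreover have "c > 0" by (simp add: c_def)
    ultimately have 1: "\<Prod>B \<le> c" by (rule dvd_imp_le)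
    \<comment> \<open>The two equal middle coefficients together are at most the row sum
      \<open>2 ^ (2 * m + 1)\<close>.\<close>
    have "2 * c = c + ((2 * m + 1) choose (m + 1))"
      unfolding c_def by (subst (2) binomial_symmetric) auto
    also have "\<dots> = (\<Sum>k\<in>{m, m + 1}. (2 * m + 1) choose k)" by (simp add: c_def)
    also have "\<dots> \<le> (\<Sum>k\<le>2 * m + 1. (2 * m + 1) choose k)" by (rule sum_mono2) auto
    also have "\<dots> = 2 * 4 ^ m" unfolding choose_row_sum by (simp add: power_mult)
    finally have 2: "c \<le> 4 ^ m" by simp
    have "{p. prime p \<and> p \<le> n} = {p. prime p \<and> p \<le> m + 1} \<union> B"
      using m by (auto simp: B_def)
    then have "(\<Prod>p | prime p \<and> p \<le> n. p) = (\<Prod>p | prime p \<and> p \<le> m + 1. p) * \<Prod>B"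
      by (auto simp: B_def intro!: prod.union_disjoint intro: finite_subset[of _ "{..n}"])
    also have "\<dots> \<le> 4 ^ (m + 1) * 4 ^ m"
      using less[of "m + 1"] m 1 2 by (intro mult_mono) auto
    also have "\<dots> = 4 ^ n" using m by (simp add: power_add mult_2 power2_eq_square power_mult)
    finally show ?thesis .
  qed
qed

text \<open>The entries of the Leibniz harmonic triangle satisfy \<open>1/b = 1/c - 1/a\<close>.\<close>

lemma leibniz_triangle_dvd_Lcm:
  "k \<le> n \<Longrightarrow> (n + 1) * (n choose k) dvd Lcm {1..n + 1}"
proof (induction k arbitrary: n)
  case 0
  then show ?case by (simp add: dvd_Lcm)
next
  case (Suc k)
  then obtain m where n: "n = Suc m" "k \<le> m" by (cases n) auto
  define a where "a = (m + 2) * (Suc m choose k)"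
  define b where "b = (m + 2) * (Suc m choose Suc k)"
  define c where "c = (m + 1) * (m choose k)"
  define l where "l = Lcm {1..m + 2}"
  have "a dvd l" using Suc.IH[of "Suc m"] n by (simp add: a_def l_def)
  have "c dvd Lcm {1..m + 1}" using Suc.IH[of m] n by (simp add: c_def)
  also have "\<dots> dvd l" unfolding l_def by (rule Lcm_subset) auto
  finally have "c dvd l" .
  obtain s where s: "l = a * s" using \<open>a dvd l\<close> by (rule dvdE)
  obtain t where t: "l = c * t" using \<open>c dvd l\<close> by (rule dvdE)
  have "Suc k * (a * b) = Suc k * (c * (a + b))"
  proof -
    have 1: "Suc k * (Suc m choose Suc k) = (m + 1) * (m choose k)"
      using Suc_times_binomial_eq[of m k] by (simp add: mult.commute)
    have 2: "Suc k * (Suc (Suc m) choose Suc k) = (m + 2) * (Suc m choose k)"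
      using Suc_times_binomial_eq[of "Suc m" k] by (simp add: mult.commute)
    have ab: "a + b = (m + 2) * (Suc (Suc m) choose Suc k)"
      by (simp add: a_def b_def algebra_simps)
    have "Suc k * (c * (a + b)) = c * (m + 2) * (Suc k * (Suc (Suc m) choose Suc k))"
      unfolding ab by (simp only: ac_simps)
    also have "\<dots> = c * (m + 2) * a" unfolding 2 a_def by simp
    also have "\<dots> = (m + 2) * (Suc k * (Suc m choose Suc k)) * a"
      unfolding 1 c_def by (simp only: ac_simps)
    also have "\<dots> = Suc k * (a * b)" unfolding b_def by (simp only: ac_simps)
    finally show ?thesis by simp
  qed
  then have eq: "a * b = c * (a + b)" by (simp only: mult_cancel1) simp
  have "a > 0" using n by (simp add: a_def)
  \<comment> \<open>In effect l/b = l/c - l/a = t - s. Integers avoid truncated subtraction.\<close>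
  have "int a * int l = int a * (int b * (int t - int s))"
  proof -
    have "int t * (int a * int b) = int t * (int c * (int a + int b))"
      using eq by (metis of_nat_add of_nat_mult)
    also have "\<dots> = int l * int a + int l * int b" by (simp add: t algebra_simps)
    also have "\<dots> = int l * int a + int a * int s * int b" by (simp add: s)
    finally show ?thesis by (simp add: algebra_simps)
  qed
  then have "int l = int b * (int t - int s)" using \<open>a > 0\<close> by simp
  then have "int b dvd int l" by simp
  then have "b dvd l" by simp
  then show ?case using n by (simp add: b_def l_def)
qed

text \<open>Each prime up to \<open>N\<close> contributes its largest power not exceeding
  \<open>N\<close>, hence a factor of at most \<open>N\<close>.\<close>

lemma Lcm_upto_le:
  fixes N :: nat
  assumes "N \<ge> 1"
  shows "Lcm {1..N} \<le> N ^ card {p. prime p \<and> p \<le> N}"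
proof -
  let ?A = "{p. prime p \<and> p \<le> N}"
  have finA: "finite ?A" by (rule finite_subset[of _ "{..N}"]) auto
  define e where "e p = (GREATEST i. p ^ i \<le> N)" for p
  have bnd: "i \<le> N" if "p ^ i \<le> N" "prime p" for p i
    using that less_exp[of i] power_mono[of 2 p i] prime_ge_2_nat[of p] by linarith
  have e1: "p ^ e p \<le> N" if "prime p" for p
    unfolding e_def by (rule GreatestI_nat[where k = 0 and b = N]) (use assms bnd that in auto)
  have e2: "i \<le> e p" if "prime p" "p ^ i \<le> N" for i p
    unfolding e_def by (rule Greatest_le_nat[where b = N]) (use bnd that in auto)
  have "Lcm {1..N} dvd (\<Prod>p\<in>?A. p ^ e p)"
  proof (rule Lcm_least)
    fix k assume k: "k \<in> {1..N}"
    have "k = (\<Prod>p\<in>prime_factors k. p ^ multiplicity p k)"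
      using k by (intro prime_factorization_nat) auto
    also have "\<dots> dvd (\<Prod>p\<in>?A. p ^ e p)"
    proof (rule prod_dvd_prod_subset2[OF finA])
      show "prime_factors k \<subseteq> ?A" using k by (auto simp: prime_factors_dvd dest!: dvd_imp_le)
      fix p assume p: "p \<in> prime_factors k"
      have "p ^ multiplicity p k \<le> k" using k by (intro dvd_imp_le multiplicity_dvd) auto
      then have "multiplicity p k \<le> e p" using p k by (intro e2) auto
      then show "p ^ multiplicity p k dvd p ^ e p" by (rule le_imp_power_dvd)
    qed
    finally show "k dvd (\<Prod>p\<in>?A. p ^ e p)" .
  qed
  then have "Lcm {1..N} \<le> (\<Prod>p\<in>?A. p ^ e p)"
    by (rule dvd_imp_le) (auto intro!: prod_pos simp: prime_gt_0_nat)
  also have "\<dots> \<le> (\<Prod>p\<in>?A. N)" using e1 by (intro prod_mono) auto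
  finally show ?thesis by simp
qed

text \<open>Chebyshev's lower bound for the number of primes: \<open>2 ^ n\<close> is at most
  \<open>n + 1\<close> times the central binomial coefficient, and that product divides
  \<open>Lcm {1..n + 1}\<close> by the Leibniz triangle.\<close>

lemma power2_le_power_prime_count:
  "2 ^ n \<le> Suc n ^ card {p. prime p \<and> p \<le> Suc n}"
proof -
  have "2 ^ n = (\<Sum>k\<le>n. n choose k)" by (simp add: choose_row_sum)
  also have "\<dots> \<le> (\<Sum>k\<le>n. n choose (n div 2))" by (intro sum_mono binomial_maximum)
  also have "\<dots> = (n + 1) * (n choose (n div 2))" by simp
  also have "\<dots> \<le> Lcm {1..n + 1}"
    using leibniz_triangle_dvd_Lcm[of "n div 2" n] by (intro dvd_imp_le) (auto simp: Lcm_0_iff intro!: Nat.gr0I)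
  also have "\<dots> \<le> Suc n ^ card {p. prime p \<and> p \<le> Suc n}" using Lcm_upto_le[of "n + 1"] by simp
  finally show ?thesis .
qed

section \<open>Reciprocals of large primes\<close>

text \<open>Split \<open>R\<close> at \<open>K * z\<close>. The primorial bound leaves at most
  \<open>K * z / h\<close> primes between \<open>z\<close> and \<open>K * z\<close> once
  \<open>4 ^ h \<le> z\<close>, and these contribute at most \<open>K / h\<close>. Each of the at
  most \<open>C * z\<close> others contributes at most \<open>1 / (K * z)\<close>, together
  \<open>C / K\<close>.\<close>

lemma sum_reciprocals_of_large_primes:
  fixes \<epsilon> :: real and C :: nat
  assumes "\<epsilon> > 0"
  shows "\<exists>Z. \<forall>z\<ge>Z. \<forall>R. finite R \<and> card R \<le> C * z \<and> (\<forall>p\<in>R. prime p \<and> p > z) \<longrightarrow>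
           (\<Sum>p\<in>R. 1 / real p) \<le> \<epsilon>"
proof -
  have large_nat: "\<exists>K::nat. K \<ge> 1 \<and> real K \<ge> x" for x
  proof -
    obtain K :: nat where "x \<le> real K" using real_arch_simple by blast
    then show ?thesis by (intro exI[of _ "Suc K"]) auto
  qed
  \<comment> \<open>\<open>K\<close> makes \<open>C / K\<close> at most half of \<epsilon>; then
    \<open>h\<close> does the same for \<open>K / h\<close>.\<close>
  obtain K :: nat where K: "K \<ge> 1" "real K \<ge> 2 * C / \<epsilon>" using large_nat by blast
  obtain h :: nat where h: "h \<ge> 1" "real h \<ge> 2 * K / \<epsilon>" using large_nat by blast
  have "(\<Sum>p\<in>R. 1 / real p) \<le> \<epsilon>"
    if z: "z \<ge> 4 ^ h" and R: "finite R" "card R \<le> C * z" "\<And>p. p \<in> R \<Longrightarrow> prime p" "\<And>p. p \<in> R \<Longrightarrow> p > z"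
    for z :: nat and R
  proof -
    have zpos: "z > 0" using z by (rule order_less_le_trans[rotated]) simp
    define A where "A = {p \<in> R. p \<le> K * z}"
    have finA: "finite A" "A \<subseteq> R" using R by (auto simp: A_def)
    have "(4::nat) ^ (h * card A) = (4 ^ h) ^ card A" by (simp add: power_mult)
    also have "\<dots> \<le> z ^ card A" using z by (intro power_mono) auto
    also have "\<dots> = (\<Prod>p\<in>A. z)" by simp
    also have "\<dots> \<le> \<Prod>A" using R(4) by (intro prod_mono) (auto simp: A_def less_imp_le)
    also have "\<dots> \<le> (\<Prod>p | prime p \<and> p \<le> K * z. p)"
    proof (rule dvd_imp_le)
      show "\<Prod>A dvd (\<Prod>p | prime p \<and> p \<le> K * z. p)"
        using R by (intro prod_dvd_prod_subset finite_subset[of "{p. prime p \<and> p \<le> K * z}" "{..K * z}"])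
          (auto simp: A_def)
    qed (auto intro!: prod_pos simp: prime_gt_0_nat)
    also have "\<dots> \<le> 4 ^ (K * z)" by (rule primorial_le)
    finally have "h * card A \<le> K * z" by simp
    then have "real h * real (card A) \<le> real K * real z" by (metis of_nat_le_iff of_nat_mult)
    then have hA: "real (card A) / z \<le> K / h" using h zpos by (simp add: field_simps)
    have "(\<Sum>p\<in>R. 1 / real p) = (\<Sum>p\<in>A. 1 / real p) + (\<Sum>p\<in>R - A. 1 / real p)"
      using finA R by (metis add.commute sum.subset_diff)
    also have "\<dots> \<le> (\<Sum>p\<in>A. 1 / real z) + (\<Sum>p\<in>R - A. 1 / (K * z))"
    proof (intro add_mono sum_mono)
      fix p assume "p \<in> A"
      then show "1 / real p \<le> 1 / real z" using R(4)[of p] zpos by (intro divide_left_mono) (auto simp: A_def)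
    next
      fix p assume "p \<in> R - A"
      then have "real p > 0" using R(3)[of p] by (simp add: prime_gt_0_nat)
      moreover have "real p \<ge> real (K * z)" using \<open>p \<in> R - A\<close> by (auto simp: A_def simp del: of_nat_mult)
      ultimately show "1 / real p \<le> 1 / real (K * z)"
        using K zpos by (intro divide_left_mono) (auto intro!: mult_pos_pos)
    qed
    also have "\<dots> \<le> card A / z + card R / (K * z)"
      using K zpos R by (auto intro!: divide_right_mono card_mono)
    also have "\<dots> \<le> K / h + C / K"
    proof (intro add_mono hA)
      have "real (card R) \<le> real C * real z" using R(2) by (metis of_nat_le_iff of_nat_mult)
      then show "card R / (K * z) \<le> C / K" using K zpos by (simp add: field_simps)
    qed
    also have "\<dots> \<le> \<epsilon> / 2 + \<epsilon> / 2"
      using K h assms by (intro add_mono) (simp_all add: field_simps)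
    finally show ?thesis by simp
  qed
  then show ?thesis by blast
qed

text \<open>Otherwise the primes up to \<open>z\<close> would be among 2 and the first
  \<open>j - 1\<close> odd primes, so at most \<open>j\<close> in number, contradicting Chebyshev's
  bound.\<close>

lemma odd_prime_le:
  assumes "j \<ge> 1" "z \<ge> 1" "z ^ j < 2 ^ (z - 1)"
  shows "odd_prime j \<le> z"
proof (rule ccontr)
  assume "\<not> odd_prime j \<le> z"
  define S where "S = {p::nat. prime p \<and> odd p}"
  have two_or_odd: "odd p" if "prime p" "p \<noteq> 2" for p :: nat
    using that prime_odd_nat[of p] prime_ge_2_nat[of p] by linarith
  have inf: "infinite S"
  proof
    assume "finite S"
    moreover have "{p::nat. prime p} \<subseteq> insert 2 S" using two_or_odd by (auto simp: S_def)
    ultimately show False using primes_infinite finite_subset by blast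
  qed
  note z = assms(2)
  have "{p. prime p \<and> p \<le> z} \<subseteq> insert 2 (enumerate S ` {..<j - 1})"
  proof
    fix p assume p: "p \<in> {p. prime p \<and> p \<le> z}"
    show "p \<in> insert 2 (enumerate S ` {..<j - 1})"
    proof (cases "p = 2")
      case False
      then have "p \<in> S" using p two_or_odd by (auto simp: S_def)
      then obtain i where i: "enumerate S i = p" using enumerate_Ex[OF inf \<open>p \<in> S\<close>] by blast
      then have "enumerate S i < enumerate S (j - 1)"
        using p \<open>\<not> odd_prime j \<le> z\<close> by (simp add: odd_prime_def S_def)
      then have "i < j - 1" using inf by simp
      then show ?thesis using i by blast
    qed simp
  qed
  then have "card {p. prime p \<and> p \<le> z} \<le> card (insert 2 (enumerate S ` {..<j - 1}))"
    by (intro card_mono) auto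
  also have "\<dots> \<le> Suc (card (enumerate S ` {..<j - 1}))" by (rule card_insert_le_m1) auto
  also have "\<dots> \<le> Suc (j - 1)" using card_image_le[of "{..<j - 1}" "enumerate S"] by simp
  finally have "card {p. prime p \<and> p \<le> z} \<le> j" using assms by simp
  then have "z ^ card {p. prime p \<and> p \<le> z} \<le> z ^ j" using z by (intro power_increasing) auto
  moreover have "2 ^ (z - 1) \<le> z ^ card {p. prime p \<and> p \<le> z}"
    using power2_le_power_prime_count[of "z - 1"] z by simp
  ultimately show False using assms by linarith
qed

section \<open>Hall's theorem with transport plans\<close>

text \<open>Induction on \<open>K\<close>. A critical nonempty proper subset is matched first, and
  the rest keeps Hall's condition outside its neighbourhood. If there is none, every nonempty proper
  subset has a neighbour to spare, so any \<open>k\<close> may take any neighbour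
  \<open>y\<close>.\<close>

lemma hall_system_of_representatives:
  fixes N :: "'a \<Rightarrow> 'b set"
  assumes "finite K" "\<And>k. k \<in> K \<Longrightarrow> finite (N k)"
    and "\<And>X. X \<subseteq> K \<Longrightarrow> card X \<le> card (\<Union>(N ` X))"
  shows "\<exists>f. inj_on f K \<and> (\<forall>k\<in>K. f k \<in> N k)"
  using assms
proof (induction K arbitrary: N rule: finite_psubset_induct)
  case (psubset K)
  note hall = psubset.prems(2)
  show ?case
  proof (cases "\<exists>X. X \<subset> K \<and> X \<noteq> {} \<and> card X = card (\<Union>(N ` X))")
    case True
    then obtain X where X: "X \<subset> K" "X \<noteq> {}" "card X = card (\<Union>(N ` X))" by blast
    have "\<exists>f. inj_on f X \<and> (\<forall>k\<in>X. f k \<in> N k)"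
      using psubset.IH[OF X(1), of N] psubset.prems(1) hall X(1) by blast
    then obtain f where f: "inj_on f X" "\<forall>k\<in>X. f k \<in> N k" by blast
    define N' where "N' k = N k - \<Union>(N ` X)" for k
    have "\<exists>g. inj_on g (K - X) \<and> (\<forall>k\<in>K - X. g k \<in> N' k)"
    proof (rule psubset.IH)
      show "K - X \<subset> K" using X by blast
      show "finite (N' k)" if "k \<in> K - X" for k using that psubset.prems(1) by (simp add: N'_def)
      fix Y assume Y: "Y \<subseteq> K - X"
      have "card X + card Y = card (X \<union> Y)"
        using Y X psubset.hyps(1) by (subst card_Un_disjoint) (auto intro: finite_subset)
      also have "\<dots> \<le> card (\<Union>(N ` (X \<union> Y)))" using hall X Y by blast
      also have "\<Union>(N ` (X \<union> Y)) = \<Union>(N ` X) \<union> \<Union>(N' ` Y)" by (auto simp: N'_def)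
      also have "card \<dots> \<le> card (\<Union>(N ` X)) + card (\<Union>(N' ` Y))" by (rule card_Un_le)
      finally show "card Y \<le> card (\<Union>(N' ` Y))" using X(3) by simp
    qed
    then obtain g where g: "inj_on g (K - X)" "\<forall>k\<in>K - X. g k \<in> N' k" by blast
    define h where "h k = (if k \<in> X then f k else g k)" for k
    have "inj_on h (X \<union> (K - X))"
      unfolding inj_on_Un
    proof (intro conjI)
      show "inj_on h X" using f(1) by (simp add: h_def inj_on_def)
      show "inj_on h (K - X)" using g(1) by (simp add: h_def inj_on_def)
      show "h ` (X - (K - X)) \<inter> h ` (K - X - X) = {}"
        using f(2) g(2) by (fastforce simp: h_def N'_def)
    qed
    moreover have "X \<union> (K - X) = K" using X by blast
    ultimately have "inj_on h K" by simp
    moreover have "\<forall>k\<in>K. h k \<in> N k" using f g by (auto simp: h_def N'_def)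
    ultimately show ?thesis by blast
  next
    case no_critical: False
    show ?thesis
    proof (cases "K = {}")
      case True then show ?thesis by simp
    next
      case nonempty: False
      then obtain k where k: "k \<in> K" by blast
      have "card {k} \<le> card (N k)" using hall[of "{k}"] k by simp
      then have "N k \<noteq> {}" by auto
      then obtain y where y: "y \<in> N k" by blast
      define N' where "N' i = N i - {y}" for i
      have "\<exists>g. inj_on g (K - {k}) \<and> (\<forall>i\<in>K - {k}. g i \<in> N' i)"
      proof (rule psubset.IH)
        show "K - {k} \<subset> K" using k by blast
        show "finite (N' i)" if "i \<in> K - {k}" for i using that psubset.prems(1) by (simp add: N'_def)
        fix Y assume Y: "Y \<subseteq> K - {k}"
        show "card Y \<le> card (\<Union>(N' ` Y))"
        proof (cases "Y = {}")
          case False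
          have "Y \<subset> K" using Y k by blast
          then have "card Y \<noteq> card (\<Union>(N ` Y))" using no_critical False by blast
          moreover have "card Y \<le> card (\<Union>(N ` Y))" using \<open>Y \<subset> K\<close> hall by blast
          moreover have "\<Union>(N' ` Y) = \<Union>(N ` Y) - {y}" by (auto simp: N'_def)
          moreover have "card (\<Union>(N ` Y)) \<le> Suc (card (\<Union>(N ` Y) - {y}))"
            by (simp add: card_Diff_singleton_if) arith
          ultimately show ?thesis by simp
        qed simp
      qed
      then obtain g where g: "inj_on g (K - {k})" "\<forall>i\<in>K - {k}. g i \<in> N' i" by blast
      have "inj_on (g(k := y)) (insert k (K - {k}))"
        using g by (subst inj_on_insert) (auto simp: N'_def inj_on_def)
      then have "inj_on (g(k := y)) K" using k by (simp add: insert_absorb)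
      moreover have "\<forall>i\<in>K. (g(k := y)) i \<in> N i" using g y by (auto simp: N'_def)
      ultimately show ?thesis by blast
    qed
  qed
qed

lemma hall_bijection:
  assumes "finite K" "finite D" "card K = card D"
    and "\<And>X. X \<subseteq> K \<Longrightarrow> card X \<le> card {d \<in> D. \<exists>k\<in>X. E k d}"
  shows "\<exists>f. bij_betw f K D \<and> (\<forall>k\<in>K. E k (f k))"
proof -
  have "\<exists>f. inj_on f K \<and> (\<forall>k\<in>K. f k \<in> {d \<in> D. E k d})"
  proof (rule hall_system_of_representatives)
    fix X assume "X \<subseteq> K"
    moreover have "\<Union>((\<lambda>k. {d \<in> D. E k d}) ` X) = {d \<in> D. \<exists>k\<in>X. E k d}" by blast
    ultimately show "card X \<le> card (\<Union>((\<lambda>k. {d \<in> D. E k d}) ` X))" using assms(4) by simp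
  qed (use assms in auto)
  then obtain f where f: "inj_on f K" "\<forall>k\<in>K. f k \<in> D \<and> E k (f k)" by auto
  have "f ` K = D"
    using f assms by (intro card_subset_eq) (auto simp: card_image)
  then show ?thesis using f by (auto simp: bij_betw_def)
qed

text \<open>Hall's condition for a graph on \<open>K\<close> and \<open>Sigma V T\<close>, from a transport plan \<open>w\<close> between the classes of \<open>K\<close>
  and the fibres over \<open>V\<close> such that each cell in the support of \<open>w\<close> satisfies a fractional Hall condition.\<close>

lemma fibred_hall:
  fixes w :: "'c \<Rightarrow> 'v \<Rightarrow> real" and cl :: "'k \<Rightarrow> 'c"
  assumes fin: "finite K" "finite V" "\<And>v. v \<in> V \<Longrightarrow> finite (T v)" "finite C"
    and cl: "\<And>k. k \<in> K \<Longrightarrow> cl k \<in> C"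
    and w_nonneg: "\<And>c v. c \<in> C \<Longrightarrow> v \<in> V \<Longrightarrow> 0 \<le> w c v"
    and w_supp: "\<And>c v. c \<in> C \<Longrightarrow> v \<in> V \<Longrightarrow> \<not> ok c v \<Longrightarrow> w c v = 0"
    and row: "\<And>c. c \<in> C \<Longrightarrow> (\<Sum>v\<in>V. w c v) = card {k \<in> K. cl k = c}"
    and col: "\<And>v. v \<in> V \<Longrightarrow> (\<Sum>c\<in>C. w c v) = card (T v)"
    and cell: "\<And>c v X. c \<in> C \<Longrightarrow> v \<in> V \<Longrightarrow> X \<subseteq> {k \<in> K. cl k = c} \<Longrightarrow>
        card X * card (T v) \<le> card {k \<in> K. cl k = c} * card {t \<in> T v. \<exists>k\<in>X. E k t}"
  shows "\<exists>f. bij_betw f K (Sigma V T) \<and>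
             (\<forall>k\<in>K. ok (cl k) (fst (f k)) \<and> E k (snd (f k)))"
proof (rule hall_bijection)
  let ?Z = "\<lambda>c. {k \<in> K. cl k = c}"
  show "finite K" "finite (Sigma V T)" using fin by auto
  have "real (card K) = (\<Sum>c\<in>C. real (card (?Z c)))"
  proof -
    have "card K = card (\<Union>c\<in>C. ?Z c)" using cl by (intro arg_cong[where f = card]) auto
    also have "\<dots> = (\<Sum>c\<in>C. card (?Z c))" using fin by (intro card_UN_disjoint) auto
    finally show ?thesis by simp
  qed
  also have "\<dots> = (\<Sum>c\<in>C. \<Sum>v\<in>V. w c v)" using row by simp
  also have "\<dots> = (\<Sum>v\<in>V. \<Sum>c\<in>C. w c v)" by (rule sum.swap)
  also have "\<dots> = (\<Sum>v\<in>V. real (card (T v)))" using col by simp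
  also have "\<dots> = real (card (Sigma V T))" using fin by (simp add: card_SigmaI)
  finally show "card K = card (Sigma V T)" by linarith
  fix X assume X: "X \<subseteq> K"
  define Xc where "Xc c = {k \<in> X. cl k = c}" for c
  define Nb where "Nb v = {t \<in> T v. \<exists>k\<in>X. ok (cl k) v \<and> E k t}" for v
  have finZ: "finite (?Z c)" for c using fin by simp
  have Xle: "card (Xc c) \<le> card (?Z c)" for c
    using X finZ by (intro card_mono) (auto simp: Xc_def)
  \<comment> \<open>Summed over all cells, the left sides give \<open>card X\<close> by the row sums
    and the right sides give the size of the neighbourhood by the column sums. An empty fibre forces
    zero weight; an empty class has left side 0 because division by zero yields 0.\<close>
  have part: "w c v * card (Xc c) / card (?Z c) \<le> w c v * card (Nb v) / card (T v)"
    if c: "c \<in> C" and v: "v \<in> V" for c v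
  proof (cases "ok c v")
    case False
    then show ?thesis using w_supp c v by simp
  next
    case True
    have finT: "finite (T v)" using fin v by simp
    show ?thesis
    proof (cases "card (T v) = 0")
      case True
      then have "(\<Sum>c\<in>C. w c v) = 0" using col v by simp
      then have "w c v = 0" using sum_nonneg_eq_0_iff[of C "\<lambda>c. w c v"] fin w_nonneg v c by auto
      then show ?thesis by simp
    next
      case Tpos: False
      show ?thesis
      proof (cases "card (?Z c) = 0")
        case True
        then show ?thesis using Tpos w_nonneg[OF c v] by simp
      next
        case Zpos: False
        have "card (Xc c) * card (T v) \<le> card (?Z c) * card {t \<in> T v. \<exists>k\<in>Xc c. E k t}"
          using cell[OF c v, of "Xc c"] X by (auto simp: Xc_def)
        also have "\<dots> \<le> card (?Z c) * card (Nb v)"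
          using True finT by (intro mult_le_mono2 card_mono) (auto simp: Xc_def Nb_def)
        finally have "real (card (Xc c)) * card (T v) \<le> real (card (?Z c)) * card (Nb v)"
          by (metis of_nat_mult of_nat_le_iff)
        then have "real (card (Xc c)) / card (?Z c) \<le> card (Nb v) / card (T v)"
          using Tpos Zpos by (simp add: field_simps)
        from mult_left_mono[OF this w_nonneg[OF c v]] show ?thesis by simp
      qed
    qed
  qed
  have "real (card X) = (\<Sum>c\<in>C. real (card (Xc c)))"
  proof -
    have "card X = card (\<Union>c\<in>C. Xc c)" using cl X by (intro arg_cong[where f = card]) (auto simp: Xc_def)
    also have "\<dots> = (\<Sum>c\<in>C. card (Xc c))"
      using fin finite_subset[OF X] by (intro card_UN_disjoint) (auto simp: Xc_def)
    finally show ?thesis by simp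
  qed
  also have "\<dots> = (\<Sum>c\<in>C. \<Sum>v\<in>V. w c v * card (Xc c) / card (?Z c))"
  proof (rule sum.cong)
    fix c assume c: "c \<in> C"
    have "(\<Sum>v\<in>V. w c v * card (Xc c) / card (?Z c)) = (\<Sum>v\<in>V. w c v) * card (Xc c) / card (?Z c)"
      by (simp add: sum_distrib_right sum_divide_distrib)
    also have "\<dots> = card (Xc c)" using row[OF c] Xle[of c] by (cases "card (?Z c) = 0") auto
    finally show "real (card (Xc c)) = (\<Sum>v\<in>V. w c v * card (Xc c) / card (?Z c))" by simp
  qed simp
  also have "\<dots> \<le> (\<Sum>c\<in>C. \<Sum>v\<in>V. w c v * card (Nb v) / card (T v))"
    using part by (intro sum_mono)
  also have "\<dots> = (\<Sum>v\<in>V. \<Sum>c\<in>C. w c v * card (Nb v) / card (T v))" by (rule sum.swap)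
  also have "\<dots> = (\<Sum>v\<in>V. real (card (Nb v)))"
  proof (rule sum.cong)
    fix v assume v: "v \<in> V"
    have "(\<Sum>c\<in>C. w c v * card (Nb v) / card (T v)) = (\<Sum>c\<in>C. w c v) * card (Nb v) / card (T v)"
      by (simp add: sum_distrib_right sum_divide_distrib)
    moreover have "card (Nb v) \<le> card (T v)" using fin v by (intro card_mono) (auto simp: Nb_def)
    ultimately show "(\<Sum>c\<in>C. w c v * card (Nb v) / card (T v)) = real (card (Nb v))"
      using col[OF v] by (cases "card (T v) = 0") auto
  qed simp
  also have "\<dots> = real (card (Sigma V Nb))"
    using fin by (subst card_SigmaI) (auto simp: Nb_def)
  also have "Sigma V Nb = {d \<in> Sigma V T. \<exists>k\<in>X. ok (cl k) (fst d) \<and> E k (snd d)}"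
    by (auto simp: Nb_def)
  finally show "card X \<le> card {d \<in> Sigma V T. \<exists>k\<in>X. ok (cl k) (fst d) \<and> E k (snd d)}" by linarith
qed

section \<open>Matching a progression\<close>

text \<open>\<open>S\<close> and \<open>R\<close> hold the small and large non-tight primes,
  \<open>e\<close> the exponents of the small ones, and \<open>P\<close> is the product of the tight
  primes. Non-tightness appears as \<open>e p + 2 \<le> p\<close>.\<close>

locale progression =
  fixes S R :: "nat set" and e :: "nat \<Rightarrow> nat" and a P z :: nat
  assumes finite_S: "finite S" and finite_R: "finite R" and disjoint: "S \<inter> R = {}"
    and prime_S: "p \<in> S \<Longrightarrow> prime p" and prime_R: "p \<in> R \<Longrightarrow> prime p"
    and e_le: "p \<in> S \<Longrightarrow> e p + 2 \<le> p"
    and not_dvd_P: "p \<in> S \<union> R \<Longrightarrow> \<not> p dvd P"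
    and prod_S_le: "\<Prod>S \<le> 4 ^ z"
    and R_gt: "p \<in> R \<Longrightarrow> z < p"
    and card_R: "63 * z \<le> card R"
    and z_ge: "16 \<le> z"
    and reciprocals_R: "(\<Sum>p\<in>R. 1 / real p) \<le> 1 / 2 ^ 128"
begin

text \<open>\<open>m\<close> counts the divisors to be matched, each encoded by an exponent vector
  in \<open>V\<close> and a subset of \<open>R\<close>. The set \<open>bad k\<close> must be avoided
  by the subset assigned to \<open>k\<close>; \<open>v0\<close> is the vector allowed for every
  residue.\<close>

definition "Q = \<Prod>S"
definition "r = card R"
definition "\<tau> = (\<Prod>p\<in>S. e p + 1)"
definition "m = \<tau> * 2 ^ r"
definition "x k = a + P * k"
definition "bad k = {p \<in> R. p dvd x k}"
definition "V = (\<Pi>\<^sub>E p\<in>S. {..e p})"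
definition "v0 = (\<lambda>p\<in>S. 0::nat)"

lemma Q_pos: "Q > 0"
  unfolding Q_def using prime_S by (auto intro!: prod_pos simp: prime_gt_0_nat)

lemma \<tau>_pos: "\<tau> > 0"
  unfolding \<tau>_def by (auto intro!: prod_pos)

lemma r_ge: "63 * z \<le> r" "1008 \<le> r"
  using card_R z_ge by (auto simp: r_def)

lemma m_ge: "2 ^ r \<le> m"
  using \<tau>_pos by (simp add: m_def)

lemma m_le: "m \<le> 2 ^ (2 * r)"
proof -
  have "\<tau> \<le> Q" unfolding \<tau>_def Q_def using e_le by (intro prod_mono) fastforce
  also have "\<dots> \<le> 4 ^ z" using prod_S_le by (simp add: Q_def)
  also have "\<dots> = 2 ^ (2 * z)" by (simp add: power_mult)
  also have "\<dots> \<le> 2 ^ r" using r_ge by (intro power_increasing) auto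
  finally have "m \<le> 2 ^ r * 2 ^ r" by (simp add: m_def)
  then show ?thesis by (simp add: mult_2 power_add)
qed

lemma coprime_P:
  assumes "p \<in> S \<union> R"
  shows "coprime P p"
proof -
  have "prime p" using assms prime_S prime_R by blast
  then have "coprime p P" using not_dvd_P[OF assms] by (rule prime_imp_coprime)
  then show ?thesis by (simp add: coprime_commute)
qed

lemma dvd_x_cong:
  assumes "p \<in> S \<union> R" "p dvd x k" "p dvd x l"
  shows "[k = l] (mod p)"
proof -
  have "[a + P * k = a + P * l] (mod p)"
    using assms by (simp add: x_def cong_def mod_eq_0_iff_dvd[THEN iffD2])
  then have "[P * k = P * l] (mod p)" by (simp add: cong_add_lcancel_nat)
  moreover have "coprime P p" using assms(1) by (rule coprime_P)
  ultimately show ?thesis by (simp add: cong_mult_lcancel_nat)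
qed

lemma dvd_x_mod: "p dvd q \<Longrightarrow> p dvd x (k mod q) \<longleftrightarrow> p dvd x k"
proof (rule cong_dvd_iff)
  assume "p dvd q"
  then have "[k mod q = k] (mod p)" by (simp add: cong_def mod_mod_cancel)
  then show "[x (k mod q) = x k] (mod p)" unfolding x_def by (intro cong_add cong_mult cong_refl)
qed

section \<open>Coupling residues with exponents of small primes\<close>

lemma card_root:
  assumes "p \<in> S"
  shows "card {i. i < p \<and> p dvd x i} = 1"
proof -
  have "prime p" "coprime P p"
    using assms coprime_P prime_S by auto
  then obtain y where y: "[P * y = Suc 0] (mod p)" using cong_solve_coprime_nat by blast
  \<comment> \<open>The root is -a/P modulo \<open>p\<close>: \<open>y\<close> inverts
    \<open>P\<close>, and \<open>(p - 1) * a\<close> stands for -a.\<close>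
  define i where "i = (y * ((p - 1) * a)) mod p"
  have "[x (y * ((p - 1) * a)) = a + 1 * ((p - 1) * a)] (mod p)"
    unfolding x_def using y by (intro cong_add cong_refl) (metis One_nat_def cong_scalar_right mult.assoc)
  moreover have "a + 1 * ((p - 1) * a) = p * a"
    using prime_gt_0_nat[OF \<open>prime p\<close>] by (cases p) auto
  ultimately have "p dvd x (y * ((p - 1) * a))" by (metis cong_dvd_iff dvd_triv_left)
  then have "p dvd x i" unfolding i_def by (simp add: dvd_x_mod)
  moreover have "i < p" using prime_gt_0_nat[OF \<open>prime p\<close>] by (simp add: i_def)
  ultimately have "{i. i < p \<and> p dvd x i} = {i}"
    using dvd_x_cong[of p] assms by (auto dest!: cong_less_modulus_unique_nat)
  then show ?thesis by simp
qed

text \<open>\<open>g p k i\<close> is the conditional probability of exponent \<open>i\<close> at \<open>p\<close> given whether \<open>p\<close> divides \<open>x k\<close>,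
  in the coupling of a residue modulo \<open>p\<close> with a uniform exponent in \<open>{..e p}\<close> that avoids common divisibility;
  it exists because \<open>1 / p < 1 / (e p + 1)\<close>.\<close>

definition g :: "nat \<Rightarrow> nat \<Rightarrow> nat \<Rightarrow> real" where
  "g p k i = (if p dvd x k then (if i = 0 then 1 else 0)
     else (1 / real (e p + 1) - (if i = 0 then 1 / real p else 0)) * (real p / (real p - 1)))"

lemma p_ge:
  assumes "p \<in> S"
  shows "real p \<ge> 2" "real (e p + 1) \<le> real p - 1"
  using e_le[OF assms] by linarith+

lemma sum_g_exponent:
  assumes "p \<in> S"
  shows "(\<Sum>i\<le>e p. g p k i) = 1"
proof (cases "p dvd x k")
  case False
  have "(\<Sum>i\<le>e p. g p k i) =
      (\<Sum>i\<le>e p. 1 / real (e p + 1) - (if i = 0 then 1 / real p else 0)) * (real p / (real p - 1))"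
    unfolding sum_distrib_right by (intro sum.cong) (simp_all add: g_def False)
  also have "(\<Sum>i\<le>e p. 1 / real (e p + 1) - (if i = 0 then 1 / real p else 0)) = 1 - 1 / real p"
    by (simp add: sum_subtractf)
  finally show ?thesis using p_ge[OF assms] by (simp add: field_simps)
qed (simp add: g_def)

text \<open>The single root puts all its mass on exponent 0; the correction \<open>1 / p\<close> at
  the other \<open>p - 1\<close> residues compensates exactly, so the total does not depend on
  \<open>i\<close>.\<close>

lemma sum_g_residue:
  assumes "p \<in> S"
  shows "(\<Sum>k<p. g p k i) = real p / real (e p + 1)"
proof -
  let ?u = "if i = 0 then 1 else 0 :: real"
  let ?w = "(1 / real (e p + 1) - (if i = 0 then 1 / real p else 0)) * (real p / (real p - 1))"
  have fin: "finite {k. k < p \<and> p dvd x k}" by simp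
  have "(\<Sum>k<p. g p k i) = (\<Sum>k\<in>{..<p} \<inter> {k. p dvd x k}. ?u) + (\<Sum>k\<in>{..<p} \<inter> - {k. p dvd x k}. ?w)"
    unfolding g_def by (rule sum.If_cases) simp
  also have "{..<p} \<inter> {k. p dvd x k} = {k. k < p \<and> p dvd x k}" by auto
  also have "{..<p} \<inter> - {k. p dvd x k} = {..<p} - {k. k < p \<and> p dvd x k}" by auto
  also have "(\<Sum>k\<in>{k. k < p \<and> p dvd x k}. ?u) = ?u" using card_root[OF assms] by simp
  also have "(\<Sum>k\<in>{..<p} - {k. k < p \<and> p dvd x k}. ?w) = (real p - 1) * ?w"
  proof -
    have "card ({..<p} - {k. k < p \<and> p dvd x k}) = p - 1"
      using card_root[OF assms] by (subst card_Diff_subset[OF fin]) auto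
    then show ?thesis using p_ge[OF assms] by (simp add: of_nat_diff)
  qed
  also have "(real p - 1) * ?w = real p * (1 / real (e p + 1) - (if i = 0 then 1 / real p else 0))"
    using p_ge[OF assms] by simp
  also have "?u + \<dots> = real p / real (e p + 1)"
    using p_ge[OF assms] by (simp add: right_diff_distrib)
  finally show ?thesis .
qed

lemma g_mod: "g p (k mod p) i = g p k i"
  by (simp add: g_def dvd_x_mod)

text \<open>Here non-tightness is essential. The worst case away from the root is
  \<open>e p + 1 = p - 1\<close>, with value \<open>1 / (p - 1) ^ 2\<close>; for
  \<open>e p + 1 = p\<close> it would be 0.\<close>

lemma g_zero_ge:
  assumes "p \<in> S"
  shows "g p k 0 \<ge> 1 / real p ^ 2"
proof -
  define t where "t = real p"
  have t: "t \<ge> 2" "0 < real (e p + 1)" "real (e p + 1) \<le> t - 1" using p_ge[OF assms] by (auto simp: t_def)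
  have "1 / t ^ 2 \<le> 1" using t by (simp add: power2_eq_square mult_le_one divide_le_eq_1 mult_ge1_I)
  moreover have "1 / t ^ 2 \<le> (1 / real (e p + 1) - 1 / t) * (t / (t - 1))"
  proof -
    have "1 / t ^ 2 \<le> 1 / (t - 1) ^ 2" using t by (intro divide_left_mono power_mono) auto
    also have "\<dots> = (1 / (t - 1) - 1 / t) * (t / (t - 1))"
    proof -
      have "1 / (t - 1) - 1 / t = 1 / ((t - 1) * t)" using t by (simp add: field_simps)
      then show ?thesis using t by (simp add: power2_eq_square)
    qed
    also have "\<dots> \<le> (1 / real (e p + 1) - 1 / t) * (t / (t - 1))"
      using t by (intro mult_right_mono diff_right_mono divide_left_mono) auto
    finally show ?thesis .
  qed
  ultimately show ?thesis by (simp add: g_def t_def)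
qed

lemma g_nonneg:
  assumes "p \<in> S"
  shows "g p k i \<ge> 0"
proof (cases "i = 0")
  case True
  have "0 \<le> 1 / real p ^ 2" by simp
  also have "\<dots> \<le> g p k 0" by (rule g_zero_ge[OF assms])
  finally show ?thesis using True by simp
next
  case False
  then show ?thesis using p_ge[OF assms] by (simp add: g_def)
qed

text \<open>Joint distribution of a uniform residue modulo \<open>Q\<close> and a uniform exponent
  vector, independent across the primes of \<open>S\<close>.\<close>

definition w :: "nat \<Rightarrow> (nat \<Rightarrow> nat) \<Rightarrow> real" where
  "w c v = (\<Prod>p\<in>S. g p c (v p)) / real Q"

lemma finite_V: "finite V"
  using finite_S by (simp add: V_def finite_PiE)

lemma v0_in_V: "v0 \<in> V"
  by (simp add: V_def v0_def)

lemma w_nonneg: "w c v \<ge> 0"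
  using g_nonneg by (simp add: w_def prod_nonneg)

lemma w_eq_0: "p \<in> S \<Longrightarrow> p dvd x c \<Longrightarrow> v p \<noteq> 0 \<Longrightarrow> w c v = 0"
  using finite_S by (auto simp: w_def g_def intro!: bexI[of _ p])

lemma sum_w_row: "(\<Sum>v\<in>V. w c v) = 1 / real Q"
proof -
  have "(\<Sum>v\<in>V. \<Prod>p\<in>S. g p c (v p)) = (\<Prod>p\<in>S. \<Sum>i\<le>e p. g p c i)"
    unfolding V_def using finite_S by (intro prod_sum_PiE[symmetric]) auto
  also have "\<dots> = 1" using sum_g_exponent by simp
  finally show ?thesis unfolding w_def by (simp flip: sum_divide_distrib)
qed

lemma sum_w_column: "(\<Sum>c<Q. w c v) = 1 / real \<tau>"
proof -
  have "(\<Sum>c<Q. \<Prod>p\<in>S. g p c (v p)) = (\<Sum>c<\<Prod>S. \<Prod>p\<in>S. g p (c mod p) (v p))"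
    by (simp add: g_mod Q_def)
  also have "\<dots> = (\<Prod>p\<in>S. \<Sum>i<p. g p i (v p))"
    by (rule sum_prod_residues[OF finite_S prime_S])
  also have "\<dots> = (\<Prod>p\<in>S. real p / real (e p + 1))" using sum_g_residue by simp
  also have "\<dots> = real Q / real \<tau>" by (simp add: Q_def \<tau>_def prod_dividef)
  finally show ?thesis unfolding w_def using Q_pos by (simp flip: sum_divide_distrib)
qed

lemma w_v0_ge: "w c v0 \<ge> 1 / real Q ^ 3"
proof -
  have "(\<Prod>p\<in>S. 1 / real p ^ 2) \<le> (\<Prod>p\<in>S. g p c (v0 p))"
    using g_zero_ge by (intro prod_mono) (auto simp: v0_def)
  moreover have "(\<Prod>p\<in>S. 1 / real p ^ 2) = 1 / real Q ^ 2"
    by (simp add: Q_def prod_dividef prod_power_distrib)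
  ultimately have "1 / real Q ^ 2 / real Q \<le> w c v0"
    unfolding w_def by (intro divide_right_mono) auto
  then show ?thesis by (simp add: power3_eq_cube power2_eq_square)
qed

text \<open>All three follow from \<open>Q \<le> 4 ^ z\<close> and \<open>63 * z \<le> r\<close>.
  With \<open>w_v0_ge\<close>, the first gives slack 2 at \<open>v0\<close>: one unit for rounding
  in a residue class, one for the removed exceptional term.\<close>

lemma mass_ge: "real m / real Q ^ 3 \<ge> 2" "real m / real Q \<ge> 2 ^ r / 4 ^ z" "real m / real Q \<ge> 4"
proof -
  have Q: "real Q \<le> 4 ^ z" "real Q > 0"
    using of_nat_mono[OF prod_S_le, where 'a = real] Q_pos by (simp_all add: Q_def[symmetric] del: of_nat_prod)
  have m: "(2::real) ^ r \<le> real m" using of_nat_mono[OF m_ge, where 'a = real] by simp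
  have "2 * real Q ^ 3 \<le> 2 * (4 ^ z) ^ 3" using Q by (intro mult_left_mono power_mono) auto
  also have "\<dots> = 2 ^ (6 * z + 1)"
  proof -
    have "(2::real) ^ (6 * z) = ((2 ^ 2) ^ z) ^ 3" by (simp only: power_mult[symmetric]) simp
    then show ?thesis by simp
  qed
  also have "\<dots> \<le> 2 ^ r" using r_ge z_ge by (intro power_increasing) auto
  also note m
  finally show "real m / real Q ^ 3 \<ge> 2" using Q(2) by (simp add: pos_le_divide_eq)
  show *: "real m / real Q \<ge> 2 ^ r / 4 ^ z" using Q m by (intro frac_le) auto
  have "(4::real) * 4 ^ z = 2 ^ (2 * z + 2)" by (simp add: power_mult power_add)
  also have "\<dots> \<le> 2 ^ r" using r_ge z_ge by (intro power_increasing) auto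
  finally have "(4::real) \<le> 2 ^ r / 4 ^ z" by (simp add: field_simps)
  then show "real m / real Q \<ge> 4" using * by linarith
qed

text \<open>Two terms divisible by more than three quarters of \<open>R\<close> would share half of \<open>R\<close>,
  whose product exceeds the length of the progression.\<close>

lemma exceptional_term:
  "\<exists>k0<m. \<forall>k<m. k \<noteq> k0 \<longrightarrow> 4 * card (bad k) \<le> 3 * r"
proof -
  have ne: "{..<m} \<noteq> {}" using \<tau>_pos by (auto simp: m_def lessThan_empty_iff)
  obtain k0 where k0: "k0 < m" and max: "\<And>k. k < m \<Longrightarrow> card (bad k) \<le> card (bad k0)"
  proof -
    \<comment> \<open>The exceptional term is one with the most bad primes, so any rival has at most
      as many.\<close>
    have "Max ((\<lambda>k. card (bad k)) ` {..<m}) \<in> (\<lambda>k. card (bad k)) ` {..<m}"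
      using ne by (intro Max_in) auto
    then obtain k0 where "k0 < m" "card (bad k0) = Max ((\<lambda>k. card (bad k)) ` {..<m})" by auto
    then show ?thesis by (intro that[of k0]) auto
  qed
  have "4 * card (bad k) \<le> 3 * r" if "k < m" "k \<noteq> k0" for k
  proof (rule ccontr)
    assume "\<not> 4 * card (bad k) \<le> 3 * r"
    note k = that this
    define I where "I = bad k \<inter> bad k0"
    have fin: "finite (bad i)" "bad i \<subseteq> R" for i using finite_R by (auto simp: bad_def)
    have "card (bad k) + card (bad k0) = card (bad k \<union> bad k0) + card I"
      unfolding I_def using fin by (intro card_Un_Int) auto
    moreover have "card (bad k \<union> bad k0) \<le> r"
      unfolding r_def using fin finite_R by (intro card_mono) auto
    ultimately have "r \<le> 2 * card I" using k max[of k] by linarith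
    have I: "finite I" "I \<subseteq> R" using fin by (auto simp: I_def)
    \<comment> \<open>Every prime in \<open>I\<close> is above 16, so the product of
      \<open>I\<close> is at least \<open>2 ^ (4 * card I)\<close>, hence at least
      \<open>2 ^ (2 * r)\<close>.\<close>
    have "m \<le> 2 ^ (2 * r)" by (rule m_le)
    also have "\<dots> \<le> 2 ^ (4 * card I)" using \<open>r \<le> 2 * card I\<close> by (intro power_increasing) auto
    also have "\<dots> = (\<Prod>p\<in>I. 16)" by (simp add: power_mult)
    also have "\<dots> \<le> \<Prod>I" using R_gt z_ge I by (intro prod_mono) fastforce
    finally have "m \<le> \<Prod>I" .
    have "[k = k0] (mod (\<Prod>p\<in>I. p))"
    proof (rule coprime_cong_prod_nat)
      show "coprime p q" if "p \<in> I" "q \<in> I" "p \<noteq> q" for p q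
        using that I prime_R by (intro primes_coprime) auto
      show "[k = k0] (mod p)" if "p \<in> I" for p
        using that I by (intro dvd_x_cong) (auto simp: I_def bad_def)
    qed
    then have "k = k0" using k k0 \<open>m \<le> \<Prod>I\<close> cong_less_modulus_unique_nat[of k k0 "\<Prod>I"] by simp
    then show False using k by simp
  qed
  then show ?thesis using k0 by blast
qed

section \<open>Counting terms divisible by many large primes\<close>

text \<open>Rankin's trick with \<open>y = 2 ^ 128\<close>; the product is at most the exponential
  of \<open>2 ^ 128\<close> times the reciprocal sum, hence at most \<open>exp 1\<close>.\<close>

lemma sum_reciprocal_products_le:
  "(\<Sum>B | B \<subseteq> R \<and> card B = t. \<Prod>p\<in>B. 1 / real p) * 2 ^ (128 * t) \<le> 4"
proof -
  have "(\<Sum>B | B \<subseteq> R \<and> card B = t. \<Prod>p\<in>B. 1 / real p) * (2 ^ 128) ^ t \<le> (\<Prod>p\<in>R. 1 + 2 ^ 128 * (1 / real p))"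
    using finite_R by (intro sum_prod_card_eq_le) auto
  also have "\<dots> \<le> (\<Prod>p\<in>R. exp (2 ^ 128 * (1 / real p)))"
    by (intro prod_mono conjI exp_ge_add_one_self) auto
  also have "\<dots> = exp (2 ^ 128 * (\<Sum>p\<in>R. 1 / real p))"
    using finite_R by (simp add: exp_sum sum_distrib_left)
  also have "\<dots> \<le> exp 1" using reciprocals_R by (simp add: field_simps)
  also have "\<dots> \<le> 4" using exp_le by linarith
  finally show ?thesis by (simp add: power_mult)
qed

text \<open>Rankin's trick with \<open>y = 1 / 16\<close>; since
  \<open>(17 / 16) ^ 8 \<le> 2\<close>, the factor \<open>(17 / 16) ^ r\<close> costs only about r/8
  in the exponent of 2.\<close>

lemma card_subsets_le: "real (card {B. B \<subseteq> R \<and> card B = t}) \<le> 2 ^ (4 * t + (r div 8 + 1))"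
proof -
  have "real (card {B. B \<subseteq> R \<and> card B = t}) * (1 / 16) ^ t \<le> (17 / 16) ^ r"
    using sum_prod_card_eq_le[OF finite_R, of "1 / 16" "\<lambda>_. 1" t] by (simp add: r_def)
  also have "\<dots> \<le> (17 / 16) ^ (8 * (r div 8 + 1))" by (intro power_increasing) auto
  also have "\<dots> = ((17 / 16) ^ 8) ^ (r div 8 + 1)" by (rule power_mult)
  also have "\<dots> \<le> (2::real) ^ (r div 8 + 1)" by (intro power_mono) (auto simp: field_simps)
  finally have "real (card {B. B \<subseteq> R \<and> card B = t}) * (1 / 16) ^ t * 16 ^ t \<le> 2 ^ (r div 8 + 1) * 16 ^ t"
    by (intro mult_right_mono) auto
  then have "real (card {B. B \<subseteq> R \<and> card B = t}) \<le> 2 ^ (r div 8 + 1) * 16 ^ t"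
    by (simp add: power_divide)
  also have "\<dots> = 2 ^ (4 * t + (r div 8 + 1))" by (simp add: power_add power_mult)
  finally show ?thesis .
qed

text \<open>Union bound over the \<open>t\<close>-subsets \<open>B\<close> of \<open>bad k\<close>.
  For fixed \<open>B\<close> the index is determined modulo \<open>Q * \<Prod>B\<close>; the last
  summand collects the rounding errors.\<close>

lemma card_many_divisors_le:
  assumes X: "X \<subseteq> {k. k < m \<and> k mod Q = c}" and t: "\<And>k. k \<in> X \<Longrightarrow> t \<le> card (bad k)"
  shows "real (card X) \<le> real m / real Q * (\<Sum>B | B \<subseteq> R \<and> card B = t. \<Prod>p\<in>B. 1 / real p)
           + real (card {B. B \<subseteq> R \<and> card B = t})"
proof -
  let ?BB = "{B. B \<subseteq> R \<and> card B = t}"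
  have finBB: "finite ?BB" using finite_R by simp
  have "X \<subseteq> (\<Union>B\<in>?BB. {k \<in> X. B \<subseteq> bad k})"
  proof
    fix k assume k: "k \<in> X"
    obtain B where "B \<subseteq> bad k" "card B = t" using obtain_subset_with_card_n[OF t[OF k]] by blast
    then show "k \<in> (\<Union>B\<in>?BB. {k \<in> X. B \<subseteq> bad k})" using k by (auto simp: bad_def)
  qed
  moreover have finX: "finite X" using X by (rule finite_subset) auto
  ultimately have "card X \<le> card (\<Union>B\<in>?BB. {k \<in> X. B \<subseteq> bad k})" using finBB by (intro card_mono) auto
  also have "\<dots> \<le> (\<Sum>B\<in>?BB. card {k \<in> X. B \<subseteq> bad k})" by (rule card_UN_le[OF finBB])
  finally have "real (card X) \<le> (\<Sum>B\<in>?BB. real (card {k \<in> X. B \<subseteq> bad k}))"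
    by (simp flip: of_nat_sum add: of_nat_le_iff)
  also have "\<dots> \<le> (\<Sum>B\<in>?BB. real m / real Q * (\<Prod>p\<in>B. 1 / real p) + 1)"
  proof (rule sum_mono)
    fix B assume B: "B \<in> ?BB"
    then have finB: "finite B" "B \<subseteq> R" using finite_R finite_subset by auto
    have posB: "\<Prod>B > 0" using finB prime_R by (auto intro!: prod_pos simp: prime_gt_0_nat)
    have cop: "coprime Q (\<Prod>B)"
      unfolding Q_def using finB disjoint prime_S prime_R
      by (intro prod_coprime_left prod_coprime_right primes_coprime) auto
    have "real (card {k \<in> X. B \<subseteq> bad k}) \<le> real m / real (Q * \<Prod>B) + 1"
    proof (rule card_cong_class_le)
      show "0 < Q * \<Prod>B" using Q_pos posB by simp
      show "{k \<in> X. B \<subseteq> bad k} \<subseteq> {..<m}" using X by auto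
      fix k l assume kl: "k \<in> {k \<in> X. B \<subseteq> bad k}" "l \<in> {k \<in> X. B \<subseteq> bad k}"
      have "[k = l] (mod Q)" using kl X by (auto simp: cong_def)
      moreover have "[k = l] (mod (\<Prod>p\<in>B. p))"
      proof (rule coprime_cong_prod_nat)
        show "coprime p q" if "p \<in> B" "q \<in> B" "p \<noteq> q" for p q
          using that finB prime_R by (intro primes_coprime) auto
        show "[k = l] (mod p)" if "p \<in> B" for p
          using that finB kl by (intro dvd_x_cong) (auto simp: bad_def)
      qed
      ultimately show "[k = l] (mod Q * \<Prod>B)" using cop by (intro coprime_cong_mult_nat)
    qed
    then show "real (card {k \<in> X. B \<subseteq> bad k}) \<le> real m / real Q * (\<Prod>p\<in>B. 1 / real p) + 1"
      by (simp add: prod_dividef)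
  qed
  also have "\<dots> = real m / real Q * (\<Sum>B\<in>?BB. \<Prod>p\<in>B. 1 / real p) + real (card ?BB)"
    by (simp add: sum.distrib sum_distrib_left)
  finally show ?thesis .
qed

lemma card_cell_le:
  assumes X: "X \<subseteq> {k. k < m \<and> k mod Q = c}" and b: "\<And>k. k \<in> X \<Longrightarrow> b \<le> card (bad k)"
    and "1 \<le> b" "4 * b \<le> 3 * r"
  shows "real (card X) * 2 ^ (b + 1) \<le> real m / real Q / 2"
proof -
  \<comment> \<open>Capping \<open>t\<close> at r/64 keeps the number of subsets small, while
    \<open>2 ^ (128 * t)\<close> still exceeds \<open>2 ^ (b + 5)\<close> because \<open>b\<close>
    is at most 3r/4.\<close>
  define t where "t = min b (r div 64)"
  define E where "E = (\<Sum>B | B \<subseteq> R \<and> card B = t. \<Prod>p\<in>B. 1 / real p)"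
  define C where "C = real (card {B. B \<subseteq> R \<and> card B = t})"
  define M where "M = real m / real Q"
  have M: "M \<ge> 4" "M \<ge> 2 ^ r / 4 ^ z" using mass_ge by (simp_all add: M_def)
  have "E \<ge> 0" unfolding E_def by (intro sum_nonneg prod_nonneg) auto
  have "b + 5 \<le> 128 * t" using assms(3,4) r_ge unfolding t_def by linarith
  then have "E * 2 ^ (b + 5) \<le> E * 2 ^ (128 * t)"
    using \<open>E \<ge> 0\<close> by (intro mult_left_mono power_increasing) auto
  also have "\<dots> \<le> 4" unfolding E_def by (rule sum_reciprocal_products_le)
  finally have E: "E * 2 ^ (b + 1) \<le> 1 / 4" by (simp add: power_add)
  have "C * 2 ^ (b + 3 + 2 * z) \<le> 2 ^ (4 * t + (r div 8 + 1)) * 2 ^ (b + 3 + 2 * z)"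
    unfolding C_def by (intro mult_right_mono card_subsets_le) auto
  also have "\<dots> = 2 ^ (4 * t + (r div 8 + 1) + (b + 3 + 2 * z))" by (simp add: power_add)
  \<comment> \<open>Up to an additive 4, the exponent is at most r/16 + r/8 + 3r/4 + 2r/63, and
    \<open>1008 \<le> r\<close> leaves enough room.\<close>
  also have "\<dots> \<le> 2 ^ r"
    using assms(3,4) r_ge unfolding t_def by (intro power_increasing) linarith+
  finally have "C * 2 ^ (b + 3) * 4 ^ z \<le> 2 ^ r" by (simp add: power_add power_mult)
  then have "C * 2 ^ (b + 3) \<le> 2 ^ r / 4 ^ z" by (simp add: field_simps)
  then have C: "C * 2 ^ (b + 1) \<le> M / 4" using M by (simp add: power_add)
  have "real (card X) \<le> M * E + C"
    unfolding M_def E_def C_def using b by (intro card_many_divisors_le[OF X]) (auto simp: t_def min.coboundedI1)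
  then have "real (card X) * 2 ^ (b + 1) \<le> (M * E + C) * 2 ^ (b + 1)" by (intro mult_right_mono) auto
  also have "\<dots> = M * (E * 2 ^ (b + 1)) + C * 2 ^ (b + 1)" by (simp add: algebra_simps)
  also have "\<dots> \<le> M * (1 / 4) + M / 4" using E C M by (intro add_mono mult_left_mono) auto
  finally show ?thesis by (simp add: M_def)
qed

section \<open>Hall's condition in the cells and the matching\<close>

text \<open>A term without bad primes is joined to all of \<open>T\<close>. Otherwise a term with
  the fewest bad primes, \<open>b\<close>, sees at least a proportion \<open>1 / 2 ^ (b + 1)\<close>
  of \<open>T\<close>, even without the empty set, whereas \<open>card_cell_le\<close> bounds
  \<open>X\<close> by that proportion of its class.\<close>

lemma cell_hall:
  assumes v: "v \<in> V" and k0: "\<And>k. k < m \<Longrightarrow> k \<noteq> k0 \<Longrightarrow> 4 * card (bad k) \<le> 3 * r"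
    and c: "c < Q" and X: "X \<subseteq> {k \<in> {..<m} - {k0}. k mod Q = c}"
    and T: "T = Pow R \<or> T = Pow R - {{}}"
  shows "card X * card T \<le> card {k \<in> {..<m} - {k0}. k mod Q = c} * card {B \<in> T. \<exists>k\<in>X. bad k \<inter> B = {}}"
proof -
  let ?Z = "{k \<in> {..<m} - {k0}. k mod Q = c}" and ?N = "{B \<in> T. \<exists>k\<in>X. bad k \<inter> B = {}}"
  have finT: "finite T" using T finite_R by auto
  have finX: "finite X" using X by (rule finite_subset) auto
  consider "X = {}" | k where "k \<in> X" "bad k = {}" | "X \<noteq> {}" "\<And>k. k \<in> X \<Longrightarrow> bad k \<noteq> {}" by blast
  then show ?thesis
  proof cases
    case 2
    then have "?N = T" by auto
    moreover have "card X \<le> card ?Z" using X by (intro card_mono) auto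
    ultimately show ?thesis by simp
  next
    case 3
    define b where "b = Min ((\<lambda>k. card (bad k)) ` X)"
    have "b \<in> (\<lambda>k. card (bad k)) ` X" unfolding b_def using 3 finX by (intro Min_in) auto
    then obtain k1 where k1: "k1 \<in> X" "card (bad k1) = b" by auto
    have b_le: "b \<le> card (bad k)" if "k \<in> X" for k unfolding b_def using that finX by (intro Min_le) auto
    have fin: "finite (bad k1)" "bad k1 \<subseteq> R" using finite_R by (auto simp: bad_def)
    have b: "1 \<le> b" "4 * b \<le> 3 * r"
    proof -
      show "1 \<le> b" using 3(2)[OF k1(1)] fin k1(2) by (metis Suc_leI card_gt_0_iff One_nat_def)
      show "4 * b \<le> 3 * r" using k0[of k1] k1 X by auto
    qed
    have "b + 1 \<le> r" using b r_ge by linarith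
    have "card (R - bad k1) = r - b"
      using fin k1 by (simp add: r_def card_Diff_subset)
    then have "card (Pow (R - bad k1) - {{}}) = 2 ^ (r - b) - 1"
      using finite_R by (simp add: card_Diff_singleton card_Pow)
    moreover have "card (Pow (R - bad k1) - {{}}) \<le> card ?N"
      using finT T k1 by (intro card_mono) (auto simp: bad_def)
    moreover have "(2::nat) ^ (r - b) = 2 * 2 ^ (r - b - 1)"
      using \<open>b + 1 \<le> r\<close> by (simp flip: power_Suc)
    moreover have "(1::nat) \<le> 2 ^ (r - b - 1)" by simp
    ultimately have N: "2 ^ (r - b - 1) \<le> card ?N" by linarith
    have "real (card X) * 2 ^ (b + 1) \<le> real m / real Q / 2"
      using X b_le b by (intro card_cell_le[of X c]) auto
    \<comment> \<open>The 2 covers rounding in the residue class and the removal of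
      \<open>k0\<close>.\<close>
    also have "\<dots> \<le> real m / real Q - 2" using mass_ge(3) by simp
    also have "\<dots> \<le> real (card ?Z)"
    proof -
      have "card {k. k < m \<and> k mod Q = c} \<le> Suc (card ({k. k < m \<and> k mod Q = c} - {k0}))"
        by (simp add: card_Diff_singleton_if) arith
      moreover have "{k. k < m \<and> k mod Q = c} - {k0} = ?Z" by auto
      ultimately have "real (card {k. k < m \<and> k mod Q = c}) \<le> real (card ?Z) + 1" by simp
      then show ?thesis using card_residue_class_ge[OF c, of m] by linarith
    qed
    finally have "real (card X * 2 ^ (b + 1)) \<le> real (card ?Z)" by simp
    then have Z: "card X * 2 ^ (b + 1) \<le> card ?Z" by (simp only: of_nat_le_iff)
    have "card T \<le> card (Pow R)" using T finite_R by (intro card_mono) auto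
    also have "\<dots> = 2 ^ r" using finite_R by (simp add: card_Pow r_def)
    also have "r = (b + 1) + (r - b - 1)" using \<open>b + 1 \<le> r\<close> by simp
    also have "(2::nat) ^ \<dots> = 2 ^ (b + 1) * 2 ^ (r - b - 1)" by (rule power_add)
    finally have "card X * card T \<le> card X * (2 ^ (b + 1) * 2 ^ (r - b - 1))" by (rule mult_le_mono2)
    also have "\<dots> = (card X * 2 ^ (b + 1)) * 2 ^ (r - b - 1)" by (simp only: mult.assoc)
    also have "\<dots> \<le> card ?Z * card ?N" using Z N by (rule mult_le_mono)
    finally show ?thesis .
  qed simp
qed

text \<open>The exceptional \<open>k0\<close> receives \<open>(v0, {})\<close>, the code of the
  divisor 1; all other terms are matched by \<open>fibred_hall\<close>.\<close>

lemma exponent_subset_matching: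
  "\<exists>f. bij_betw f {..<m} (V \<times> Pow R) \<and>
     (\<forall>k<m. (\<forall>p\<in>S. p dvd x k \<longrightarrow> fst (f k) p = 0) \<and> bad k \<inter> snd (f k) = {})"
proof -
  obtain k0 where k0: "k0 < m" "\<And>k. k < m \<Longrightarrow> k \<noteq> k0 \<Longrightarrow> 4 * card (bad k) \<le> 3 * r"
    using exceptional_term by blast
  define K where "K = {..<m} - {k0}"
  define Z where "Z c = {k \<in> K. k mod Q = c}" for c
  define T where "T v = Pow R - (if v = v0 then {{}} else {})" for v
  \<comment> \<open>\<open>m * w\<close> has row sums \<open>m / Q\<close> instead of
    \<open>card (Z c)\<close>; the difference is charged to \<open>v0\<close>. This lowers the
    column sum at \<open>v0\<close> by exactly 1, agreeing with the empty set removed from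
    \<open>T v0\<close>.\<close>
  define W where "W c v = real m * w c v + (if v = v0 then real (card (Z c)) - real m / real Q else 0)" for c v
  define cop where "cop c v \<longleftrightarrow> (\<forall>p\<in>S. p dvd x c \<longrightarrow> v p = 0)" for c and v :: "nat \<Rightarrow> nat"
  have finK: "finite K" by (simp add: K_def)
  have "\<exists>f. bij_betw f K (Sigma V T) \<and> (\<forall>k\<in>K. cop (k mod Q) (fst (f k)) \<and> bad k \<inter> snd (f k) = {})"
  proof (rule fibred_hall[where C = "{..<Q}" and w = W])
    show "finite K" "finite V" "finite {..<Q}" using finK finite_V by auto
    show "finite (T v)" if "v \<in> V" for v using finite_R by (simp add: T_def)
    show "k mod Q \<in> {..<Q}" for k using Q_pos by simp
    show "W c v = 0" if not_cop: "\<not> cop c v" for c v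
    proof -
      obtain p where "p \<in> S" "p dvd x c" "v p \<noteq> 0" using not_cop by (auto simp: cop_def)
      then show ?thesis by (auto simp: W_def w_eq_0 v0_def)
    qed
    show "0 \<le> W c v" if "c \<in> {..<Q}" for c v
    proof (cases "v = v0")
      case True
      have "card {k. k < m \<and> k mod Q = c} \<le> Suc (card ({k. k < m \<and> k mod Q = c} - {k0}))"
        by (simp add: card_Diff_singleton_if) arith
      moreover have "{k. k < m \<and> k mod Q = c} - {k0} = Z c" by (auto simp: Z_def K_def)
      ultimately have "real (card {k. k < m \<and> k mod Q = c}) \<le> real (card (Z c)) + 1" by simp
      moreover have "real m / real Q - 1 \<le> real (card {k. k < m \<and> k mod Q = c})"
        using that by (intro card_residue_class_ge) simp
      moreover have "2 \<le> real m * w c v0"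
      proof -
        have "2 \<le> real m * (1 / real Q ^ 3)" using mass_ge(1) by simp
        also have "\<dots> \<le> real m * w c v0" by (intro mult_left_mono w_v0_ge) auto
        finally show ?thesis .
      qed
      ultimately show ?thesis by (simp add: W_def True)
    qed (simp add: W_def w_nonneg)
    show "(\<Sum>v\<in>V. W c v) = real (card {k \<in> K. k mod Q = c})" for c
    proof -
      have "(\<Sum>v\<in>V. W c v) = real m * (\<Sum>v\<in>V. w c v) + (real (card (Z c)) - real m / real Q)"
        using finite_V v0_in_V by (simp add: W_def sum.distrib sum_distrib_left)
      then show ?thesis by (simp add: sum_w_row Z_def)
    qed
    show "(\<Sum>c\<in>{..<Q}. W c v) = real (card (T v))" if "v \<in> V" for v
    proof -
      have "(\<Sum>c<Q. W c v) = real m * (\<Sum>c<Q. w c v)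
          + (if v = v0 then (\<Sum>c<Q. real (card (Z c))) - real m else 0)"
        using Q_pos by (simp add: W_def sum.distrib sum_distrib_left sum_subtractf)
      moreover have "real m * (\<Sum>c<Q. w c v) = 2 ^ r"
        using \<tau>_pos by (simp add: sum_w_column m_def)
      moreover have "(\<Sum>c<Q. real (card (Z c))) = real m - 1"
      proof -
        have "card K = card (\<Union>c<Q. Z c)" using Q_pos by (intro arg_cong[where f = card]) (auto simp: Z_def)
        also have "\<dots> = (\<Sum>c<Q. card (Z c))"
          using finK by (intro card_UN_disjoint) (auto simp: Z_def)
        finally have "(\<Sum>c<Q. card (Z c)) = m - 1" using k0(1) by (simp add: K_def)
        then have "real (\<Sum>c<Q. card (Z c)) = real m - 1" using k0(1) by (simp add: of_nat_diff)
        then show ?thesis by simp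
      qed
      moreover have "card (Pow R) = 2 ^ r" using finite_R by (simp add: card_Pow r_def)
      then have "real (card (T v)) = 2 ^ r - (if v = v0 then 1 else 0)"
        using finite_R by (simp add: T_def card_Diff_singleton of_nat_diff)
      ultimately show ?thesis by simp
    qed
    show "card X * card (T v) \<le> card {k \<in> K. k mod Q = c} * card {t \<in> T v. \<exists>k\<in>X. bad k \<inter> t = {}}"
      if "c \<in> {..<Q}" "v \<in> V" "X \<subseteq> {k \<in> K. k mod Q = c}" for c v X
      using that k0(2) unfolding K_def by (intro cell_hall) (auto simp: T_def)
  qed
  then obtain f where f: "bij_betw f K (Sigma V T)"
    "\<And>k. k \<in> K \<Longrightarrow> cop (k mod Q) (fst (f k)) \<and> bad k \<inter> snd (f k) = {}" by blast
  define h where "h = f(k0 := (v0, {}))"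
  have "bij_betw h K (Sigma V T)"
    using f(1) by (rule bij_betw_cong[THEN iffD1, rotated]) (auto simp: h_def K_def)
  moreover have "h k0 = (v0, {})" by (simp add: h_def)
  moreover have "k0 \<notin> K" "(v0, {}) \<notin> Sigma V T" by (auto simp: K_def T_def)
  ultimately have "bij_betw h (K \<union> {k0}) (Sigma V T \<union> {(v0, {})})"
    using notIn_Un_bij_betw[of k0 K h "Sigma V T"] by simp
  moreover have "K \<union> {k0} = {..<m}" using k0(1) by (auto simp: K_def)
  moreover have "Sigma V T \<union> {(v0, {})} = V \<times> Pow R" using v0_in_V by (auto simp: T_def split: if_splits)
  ultimately have "bij_betw h {..<m} (V \<times> Pow R)" by simp
  moreover have "(\<forall>p\<in>S. p dvd x k \<longrightarrow> fst (h k) p = 0) \<and> bad k \<inter> snd (h k) = {}" if "k < m" for k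
  proof (cases "k = k0")
    case False
    then have "k \<in> K" "h k = f k" using that by (auto simp: K_def h_def)
    moreover have "p dvd x (k mod Q) \<longleftrightarrow> p dvd x k" if "p \<in> S" for p
      using that finite_S by (intro dvd_x_mod) (auto simp: Q_def intro: dvd_prodI)
    ultimately show ?thesis using f(2)[of k] by (simp add: cop_def)
  qed (simp add: h_def v0_def)
  ultimately show ?thesis by blast
qed

lemma coprime_matching:
  "\<exists>f. bij_betw f {..<m} (divisors ((\<Prod>p\<in>S. p ^ e p) * \<Prod>R)) \<and> (\<forall>k<m. coprime (a + P * k) (f k))"
proof -
  obtain f where f: "bij_betw f {..<m} (V \<times> Pow R)"
    "\<And>k. k < m \<Longrightarrow> (\<forall>p\<in>S. p dvd x k \<longrightarrow> fst (f k) p = 0) \<and> bad k \<inter> snd (f k) = {}"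
    using exponent_subset_matching by blast
  let ?A = "\<Prod>p\<in>S. p ^ e p"
  have cop: "coprime ?A (\<Prod>R)"
    using disjoint prime_S prime_R
    by (intro prod_coprime_left prod_coprime_right) (auto intro!: primes_coprime simp: coprime_power_left_iff)
  have pos: "?A > 0" "\<Prod>R > 0"
    using prime_S prime_R by (auto intro!: prod_pos simp: prime_gt_0_nat)
  have "bij_betw (map_prod (\<lambda>v. \<Prod>p\<in>S. p ^ v p) \<Prod>) (V \<times> Pow R) (divisors ?A \<times> divisors (\<Prod>R))"
    unfolding V_def
    by (intro bij_betw_map_prod bij_betw_exponents_divisors bij_betw_Pow_divisors finite_S finite_R prime_S prime_R)
  then have "bij_betw ((\<lambda>(a, b). a * b) \<circ> (map_prod (\<lambda>v. \<Prod>p\<in>S. p ^ v p) \<Prod> \<circ> f)) {..<m}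
      (divisors (?A * \<Prod>R))"
    using f(1) bij_betw_divisors_mult[OF cop pos] by (blast intro: bij_betw_trans)
  moreover have "coprime (a + P * k) (((\<lambda>(a, b). a * b) \<circ> (map_prod (\<lambda>v. \<Prod>p\<in>S. p ^ v p) \<Prod> \<circ> f)) k)"
    if k: "k < m" for k
  proof -
    obtain v B where vB: "f k = (v, B)" by fastforce
    have "f k \<in> V \<times> Pow R" using f(1) k by (auto dest: bij_betwE)
    then have "B \<subseteq> R" using vB by simp
    have "coprime (x k) (\<Prod>p\<in>S. p ^ v p)"
      using prime_S f(2)[OF k] vB by (intro coprime_prod_prime_powers) auto
    moreover have "coprime (x k) (\<Prod>B)"
    proof (rule prod_coprime_right)
      fix p assume "p \<in> B"
      then have "prime p" "\<not> p dvd x k"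
        using \<open>B \<subseteq> R\<close> prime_R f(2)[OF k] vB by (auto simp: bad_def)
      then have "coprime p (x k)" by (rule prime_imp_coprime)
      then show "coprime (x k) p" by (simp add: coprime_commute)
    qed
    ultimately show ?thesis by (simp add: vB x_def)
  qed
  ultimately show ?thesis by blast
qed

end

section \<open>Reduction to the non-tight part\<close>

text \<open>Each \<open>x\<close> is written as \<open>1 + i + P * k\<close>, the shift reflecting
  that arguments start at 1. The class \<open>i\<close> selects the divisor of \<open>A\<close> and
  a matching \<open>f (1 + i)\<close>, and \<open>k\<close> selects the divisor of
  \<open>N\<close>.\<close>

lemma matchable_from_progressions:
  fixes T :: "nat set" and N :: nat
  defines "P \<equiv> \<Prod>T" and "A \<equiv> \<Prod>p\<in>T. p ^ (p - 1)"
  assumes T: "finite T" "\<And>p. p \<in> T \<Longrightarrow> prime p" and N: "N > 0" "coprime A N"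
    and matching: "\<And>a. \<exists>f. bij_betw f {..<m} (divisors N) \<and> (\<forall>k<m. coprime (a + P * k) (f k))"
  shows "matchable (A * N)"
proof -
  obtain f where f: "\<And>a. bij_betw (f a) {..<m} (divisors N)" "\<And>a k. k < m \<Longrightarrow> coprime (a + P * k) (f a k)"
    using matching by metis
  have posP: "P > 0" unfolding P_def using T by (auto intro!: prod_pos simp: prime_gt_0_nat)
  have posA: "A > 0" unfolding A_def using T by (auto intro!: prod_pos simp: prime_gt_0_nat)
  \<comment> \<open>The exponent at \<open>p\<close> is the residue of \<open>x\<close> itself: it
    runs through all of \<open>{..p - 1}\<close>, the full range at a tight prime, and is 0 exactly
    when \<open>p\<close> divides \<open>x\<close>.\<close>
  define \<theta> where "\<theta> i = (\<Prod>p\<in>T. p ^ ((1 + i) mod p))" for i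
  have "{..<p} = {..p - 1}" if "p \<in> T" for p using prime_gt_0_nat[OF T(2)[OF that]] by auto
  then have "bij_betw (\<lambda>k. \<lambda>p\<in>T. (1 + k) mod p) {..<P} (\<Pi>\<^sub>E p\<in>T. {..p - 1})"
    using bij_betw_residues[OF T, of 1] by (simp add: P_def cong: PiE_cong)
  from bij_betw_trans[OF this bij_betw_exponents_divisors[OF T]]
  have "bij_betw (\<lambda>i. \<Prod>p\<in>T. p ^ (\<lambda>p\<in>T. (1 + i) mod p) p) {..<P} (divisors A)"
    by (simp add: comp_def A_def)
  then have \<theta>: "bij_betw \<theta> {..<P} (divisors A)"
    by (simp add: \<theta>_def[abs_def] cong: prod.cong)
  have bij_mult: "bij_betw (\<lambda>(a, b). a * b) (divisors A \<times> divisors N) (divisors (A * N))"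
    using N posA by (intro bij_betw_divisors_mult)
  have "card (divisors A) = P" "card (divisors N) = m"
    using bij_betw_same_card[OF \<theta>] bij_betw_same_card[OF f(1)] by simp_all
  then have tau: "tau (A * N) = P * m"
    using bij_betw_same_card[OF bij_mult] by (simp add: tau_def card_cartesian_product)
  define i where "i x = (x - 1) mod P" for x
  define k where "k x = (x - 1) div P" for x
  define \<psi> where "\<psi> x = \<theta> (i x) * f (1 + i x) (k x)" for x
  have x_eq: "x = 1 + i x + P * k x" if "x \<in> {1..P * m}" for x
    using that unfolding i_def k_def by auto
  have i_lt: "i x < P" for x using posP by (simp add: i_def)
  have k_lt: "k x < m" if "x \<in> {1..P * m}" for x
    unfolding k_def using that by (intro less_mult_imp_div_less) (simp add: mult.commute, linarith)
  have mem: "(\<theta> (i x), f (1 + i x) (k x)) \<in> divisors A \<times> divisors N" if "x \<in> {1..P * m}" for x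
    using i_lt k_lt[OF that] bij_betwE[OF \<theta>] bij_betwE[OF f(1)] by auto
  have inj: "inj_on \<psi> {1..P * m}"
  proof (rule inj_onI)
    fix x y assume x: "x \<in> {1..P * m}" and y: "y \<in> {1..P * m}" and eq: "\<psi> x = \<psi> y"
    have pair: "(\<theta> (i x), f (1 + i x) (k x)) = (\<theta> (i y), f (1 + i y) (k y))"
      using eq by (intro inj_onD[OF bij_betw_imp_inj_on[OF bij_mult] _ mem[OF x] mem[OF y]]) (simp add: \<psi>_def)
    have "\<theta> (i x) = \<theta> (i y)" using pair by simp
    then have i: "i x = i y"
      by (rule inj_onD[OF bij_betw_imp_inj_on[OF \<theta>]]) (simp_all add: i_lt)
    have "f (1 + i x) (k x) = f (1 + i x) (k y)" using pair i by simp
    then have "k x = k y"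
      by (rule inj_onD[OF bij_betw_imp_inj_on[OF f(1)]]) (simp_all add: k_lt[OF x] k_lt[OF y])
    then show "x = y" using i x_eq[OF x] x_eq[OF y] by simp
  qed
  have "\<psi> ` {1..P * m} \<subseteq> divisors (A * N)"
  proof (rule image_subsetI)
    fix x assume "x \<in> {1..P * m}"
    from bspec[OF bij_betwE[OF bij_mult] mem[OF this]] show "\<psi> x \<in> divisors (A * N)"
      by (simp add: \<psi>_def)
  qed
  moreover have "card (\<psi> ` {1..P * m}) = card (divisors (A * N))"
    using inj tau by (simp add: card_image tau_def)
  moreover have "finite (divisors (A * N))" using posA N by (simp add: divisors_def finite_divisors_nat)
  ultimately have "bij_betw \<psi> {1..P * m} (divisors (A * N))"
    using inj by (simp add: bij_betw_def card_subset_eq)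
  moreover have "coprime x (\<psi> x)" if x: "x \<in> {1..P * m}" for x
  proof -
    have "coprime x (f (1 + i x) (k x))" using f(2)[OF k_lt[OF x], of "1 + i x"] x_eq[OF x] by simp
    moreover have "coprime x (\<theta> (i x))"
      unfolding \<theta>_def
    proof (rule coprime_prod_prime_powers)
      fix p assume p: "p \<in> T" "p dvd x"
      then have "p dvd P * k x" using T by (auto simp: P_def intro: dvd_mult2 dvd_prodI)
      then have "p dvd 1 + i x" using p(2) x_eq[OF x] by (metis dvd_add_left_iff)
      then show "(1 + i x) mod p = 0" by (simp add: mod_eq_0_iff_dvd)
    qed (use T in auto)
    ultimately show ?thesis by (simp add: \<psi>_def)
  qed
  ultimately show ?thesis using posA N tau by (auto simp: matchable_def)
qed

section \<open>Choice of the threshold and conclusion\<close>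

text \<open>With \<open>4 ^ h \<le> z < 4 ^ (h + 1)\<close> one gets \<open>j < 2 ^ (h + 4)\<close>,
  so \<open>z ^ j\<close> is at most 2 to the power \<open>2 * (h + 1) * 2 ^ (h + 4)\<close>, which
  \<open>4 ^ h\<close> outgrows.\<close>

lemma power_floor_sqrt_less:
  assumes "4 ^ 9 \<le> l div 64" "j = nat \<lfloor>sqrt (real l)\<rfloor>"
  shows "(l div 64) ^ j < 2 ^ (l div 64 - 1)"
proof -
  define z where "z = l div 64"
  have z: "(4::nat) ^ 9 \<le> z" using assms(1) by (simp add: z_def)
  obtain h where h: "4 ^ h \<le> z" "z < 4 ^ (h + 1)" using ex_power_ivl1[of 4 z] z by auto
  have "h \<ge> 9"
  proof (rule ccontr)
    assume "\<not> h \<ge> 9"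
    then have "(4::nat) ^ (h + 1) \<le> 4 ^ 9" by (intro power_increasing) auto
    then show False using h z by linarith
  qed
  have "real j \<le> sqrt (real l)" using assms(2) by simp
  then have "real j ^ 2 \<le> real l" by (metis of_nat_0_le_iff power_mono real_sqrt_pow2)
  then have "j ^ 2 \<le> l" by (metis of_nat_le_iff of_nat_power)
  also have "l < 64 * 4 ^ (h + 1)" using h(2) unfolding z_def by linarith
  also have "64 * 4 ^ (h + 1) = ((2::nat) ^ 2) ^ (h + 4)" by (simp add: power_add)
  also have "\<dots> = (2 ^ (h + 4)) ^ 2" by (simp only: power_mult[symmetric] mult.commute)
  finally have "j < 2 ^ (h + 4)" by (rule power_less_imp_less_base) simp
  \<comment> \<open>This fails at \<open>h = 8\<close>, whence the bound
    \<open>4 ^ 9\<close>.\<close>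
  have "2 ^ h \<ge> 32 * (h + 1) + (2::nat)"
    using \<open>h \<ge> 9\<close> by (induction h rule: dec_induct) auto
  then have "(32 * (h + 1) + 2) * 2 ^ h \<le> 2 ^ h * (2::nat) ^ h" by (rule mult_le_mono1)
  also have "\<dots> = 4 ^ h" by (simp flip: power_mult_distrib)
  finally have big: "2 * (h + 1) * 2 ^ (h + 4) + 2 * 2 ^ h \<le> (4::nat) ^ h" by (simp add: power_add algebra_simps)
  have "z ^ j \<le> (4 ^ (h + 1)) ^ j" using h(2) by (intro power_mono) auto
  also have "\<dots> = ((2 ^ 2) ^ (h + 1)) ^ j" by simp
  also have "\<dots> = 2 ^ (2 * (h + 1) * j)" by (simp only: power_mult)
  also have "\<dots> < (2::nat) ^ (z - 1)"
  proof (rule power_strict_increasing)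
    have "2 * (h + 1) * j \<le> 2 * (h + 1) * 2 ^ (h + 4)" using \<open>j < 2 ^ (h + 4)\<close> by (intro mult_le_mono2) simp
    moreover have "(1::nat) \<le> 2 ^ h" by simp
    ultimately show "2 * (h + 1) * j < z - 1" using big h(1) by linarith
  qed simp
  finally show ?thesis by (simp add: z_def)
qed

theorem theorem5p2:
  shows "\<exists>L::nat. \<forall>n l j::nat.
           M_number n \<longrightarrow>
           l = omega (non_tight_part n) \<longrightarrow>
           l \<ge> L \<longrightarrow>
           j = nat \<lfloor>sqrt (real l)\<rfloor> \<longrightarrow>
           (\<forall>q. non_tight n q \<and> q > odd_prime j \<longrightarrow> \<not> q ^ 2 dvd n) \<longrightarrow>
           matchable n"
proof -
  have "(0::real) < 1 / 2 ^ 128" by simp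
  \<comment> \<open>The constant 128 arises from
    \<open>card R \<le> l < 64 * z + 64 \<le> 128 * z\<close>.\<close>
  from sum_reciprocals_of_large_primes[OF this, of 128] obtain Z where
    "\<forall>z\<ge>Z. \<forall>R. finite R \<and> card R \<le> 128 * z \<and> (\<forall>p\<in>R. prime p \<and> p > z) \<longrightarrow>
      (\<Sum>p\<in>R. 1 / real p) \<le> 1 / 2 ^ 128" by (rule exE)
  then have Z: "(\<Sum>p\<in>R. 1 / real p) \<le> 1 / 2 ^ 128"
    if "z \<ge> Z" "finite R" "card R \<le> 128 * z" "\<And>p. p \<in> R \<Longrightarrow> prime p \<and> p > z" for z R
    using that by blast
  \<comment> \<open>The bound on \<open>l\<close> makes \<open>z = l div 64\<close> at least both
    \<open>Z\<close> and \<open>4 ^ 9\<close>.\<close>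
  have "matchable n"
    if n: "M_number n" and l: "l = omega (non_tight_part n)" and l_ge: "l \<ge> 64 * (Z + 4 ^ 9)"
      and j: "j = nat \<lfloor>sqrt (real l)\<rfloor>"
      and sq: "\<And>q. non_tight n q \<Longrightarrow> q > odd_prime j \<Longrightarrow> \<not> q ^ 2 dvd n" for n l j
  proof -
    define T where "T = {p. tight n p}"
    define F where "F = {p. non_tight n p}"
    define v where "v p = multiplicity p n" for p
    define A where "A = (\<Prod>p\<in>T. p ^ (p - 1))"
    define N where "N = (\<Prod>p\<in>F. p ^ v p)"
    have n_pos: "n > 0" and v_le: "\<And>p. prime p \<Longrightarrow> v p \<le> p - 1"
      using n by (auto simp: M_number_def v_def)
    have TF: "T \<union> F = prime_factors n" "T \<inter> F = {}"
      by (auto simp: T_def F_def tight_def non_tight_def)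
    have fin: "finite T" "finite F" using TF(1) by (metis finite_Un finite_set_mset)+
    have prime_T: "prime p" if "p \<in> T" for p using that by (auto simp: T_def tight_def)
    have prime_F: "prime p" if "p \<in> F" for p using that by (auto simp: F_def non_tight_def)
    have A_pos: "A > 0" unfolding A_def using prime_T by (auto intro!: prod_pos simp: prime_gt_0_nat)
    have N_pos: "N > 0" unfolding N_def using prime_F by (auto intro!: prod_pos simp: prime_gt_0_nat)
    have "n = (\<Prod>p\<in>T \<union> F. p ^ v p)"
      unfolding TF(1) v_def using n_pos by (intro prime_factorization_nat)
    also have "\<dots> = (\<Prod>p\<in>T. p ^ v p) * N"
      unfolding N_def using fin TF(2) by (rule prod.union_disjoint)
    also have "(\<Prod>p\<in>T. p ^ v p) = A"
      unfolding A_def by (intro prod.cong) (auto simp: T_def tight_def v_def)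
    finally have n_eq: "n = A * N" .
    have "coprime A N"
      unfolding A_def N_def using TF(2) prime_T prime_F
      by (intro prod_coprime_left prod_coprime_right) (auto intro!: primes_coprime coprime_power_left_iff[THEN iffD2] coprime_power_right_iff[THEN iffD2])
    have "prime_factors N = F"
    proof -
      have "multiplicity p N = (if p \<in> F then v p else 0)" if "prime p" for p
        unfolding N_def using fin prime_F that by (intro multiplicity_prod_prime_powers)
      moreover have "v p > 0" if "p \<in> F" for p
        using that by (auto simp: v_def F_def non_tight_def prime_factors_multiplicity)
      ultimately show ?thesis using prime_F by (auto simp: prime_factors_multiplicity split: if_splits)
    qed
    moreover have "non_tight_part n = N"
    proof -
      have "tight_part n = A" by (simp add: tight_part_def A_def T_def)
      then have "non_tight_part n = n div A" by (simp add: non_tight_part_def)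
      also have "\<dots> = N" unfolding n_eq using A_pos by simp
      finally show ?thesis .
    qed
    ultimately have card_F: "card F = l" by (simp add: l omega_def)
    define z where "z = l div 64"
    have z: "z \<ge> Z" "z \<ge> 4 ^ 9" "64 * z \<le> l" "l < 64 * z + 64"
    proof -
      have "Z + 4 ^ 9 \<le> z" using div_le_mono[OF l_ge, of 64] by (simp add: z_def)
      then show "z \<ge> Z" "z \<ge> 4 ^ 9" by simp_all
      show "64 * z \<le> l" "l < 64 * z + 64" unfolding z_def by linarith+
    qed
    \<comment> \<open>Hence the square condition applies to every non-tight prime above
      \<open>z\<close>, which forces exponent 1 on \<open>R\<close>.\<close>
    have "odd_prime j \<le> z"
    proof (rule odd_prime_le)
      have "1 \<le> real l" using z by simp
      then show "j \<ge> 1" using j by (simp add: le_nat_floor)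
      show "z \<ge> 1" using z by simp
      show "z ^ j < 2 ^ (z - 1)" using power_floor_sqrt_less[OF _ j] z(2) by (simp add: z_def)
    qed
    define S where "S = {p \<in> F. p \<le> z}"
    define R where "R = {p \<in> F. p > z}"
    have SR: "S \<union> R = F" "S \<inter> R = {}" "finite S" "finite R" using fin by (auto simp: S_def R_def)
    \<comment> \<open>At most \<open>z\<close> of the at least \<open>64 * z\<close> non-tight
      primes are small, so \<open>63 * z\<close> remain for \<open>R\<close>.\<close>
    have "card S \<le> card {1..z}"
      using prime_F prime_gt_0_nat by (intro card_mono) (auto simp: S_def Suc_le_eq)
    moreover have card_SR: "card S + card R = l"
      using card_Un_disjoint[of S R] SR card_F by simp
    ultimately have card_R: "63 * z \<le> card R" "card R \<le> 128 * z" using z by simp_all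
    have v_R: "v q = 1" if "q \<in> R" for q
    proof -
      have "\<not> q ^ 2 dvd n"
        using that \<open>odd_prime j \<le> z\<close> by (intro sq) (auto simp: R_def F_def)
      then have "v q < 2" using n_pos multiplicity_dvd'[of 2 q n] unfolding v_def by (meson linorder_not_le)
      moreover have "v q > 0"
        using that by (auto simp: v_def R_def F_def non_tight_def prime_factors_multiplicity)
      ultimately show ?thesis by simp
    qed
    have "N = (\<Prod>p\<in>S. p ^ v p) * (\<Prod>p\<in>R. p ^ v p)"
      unfolding N_def SR(1)[symmetric] using SR by (intro prod.union_disjoint)
    then have N_eq: "N = (\<Prod>p\<in>S. p ^ v p) * \<Prod>R" using v_R by simp
    have not_dvd: "\<not> p dvd \<Prod>T" if p: "p \<in> F" for p
    proof
      assume "p dvd \<Prod>T"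
      then obtain q where "q \<in> T" "p dvd q"
        using prime_dvd_prod_iff[OF fin(1), of p "\<lambda>q. q"] prime_F[OF p] by auto
      then have "p = q" using p prime_T prime_F primes_dvd_imp_eq by blast
      then show False using TF(2) \<open>q \<in> T\<close> p by blast
    qed
    have prog: "progression S R v (\<Prod>T) z"
    proof
      show "finite S" "finite R" "S \<inter> R = {}" "63 * z \<le> card R" using SR card_R by auto
      show "prime p" if "p \<in> S" for p using that prime_F by (simp add: S_def)
      show "prime p" if "p \<in> R" for p using that prime_F by (simp add: R_def)
      show "v p + 2 \<le> p" if "p \<in> S" for p
      proof -
        have "v p \<noteq> p - 1" using that by (simp add: S_def F_def non_tight_def v_def)
        moreover have "prime p" using that prime_F by (simp add: S_def)
        ultimately show ?thesis using v_le[of p] prime_ge_2_nat[of p] by linarith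
      qed
      show "\<not> p dvd \<Prod>T" if "p \<in> S \<union> R" for p using that not_dvd SR(1) by blast
      have "\<Prod>S dvd (\<Prod>p | prime p \<and> p \<le> z. p)"
        using prime_F by (intro prod_dvd_prod_subset finite_subset[of "{p. prime p \<and> p \<le> z}" "{..z}"])
          (auto simp: S_def)
      then have "\<Prod>S \<le> (\<Prod>p | prime p \<and> p \<le> z. p)"
        by (rule dvd_imp_le) (auto intro!: prod_pos simp: prime_gt_0_nat)
      then show "\<Prod>S \<le> 4 ^ z" using primorial_le[of z] by (rule order_trans)
      show "z < p" if "p \<in> R" for p using that by (simp add: R_def)
      show "16 \<le> z" using z(2) by simp
      show "(\<Sum>p\<in>R. 1 / real p) \<le> 1 / 2 ^ 128"
        using SR card_R prime_F by (intro Z[OF z(1)]) (auto simp: R_def)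
    qed
    have "matchable (A * N)"
      unfolding A_def
    proof (rule matchable_from_progressions[OF fin(1) prime_T N_pos])
      show "coprime (\<Prod>p\<in>T. p ^ (p - 1)) N" using \<open>coprime A N\<close> by (simp add: A_def)
      show "\<exists>f. bij_betw f {..<progression.m S R v} (divisors N) \<and> (\<forall>k<progression.m S R v. coprime (a + \<Prod>T * k) (f k))" for a
        using progression.coprime_matching[OF prog] unfolding N_eq .
    qed
    then show ?thesis by (simp add: n_eq)
  qed
  then show ?thesis by blast
qed

end
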